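(* Let $A$ be an associative algebra and $M$ an $A$-bimodule. Then the pair $\big(CY^\bullet(M,A)=\oplus_{n\ge 0}CY^n(M,A),\ \llbracket\ ,\ \rrbracket\big)$ (with elements of $CY^n(M,A)$ in degree $n$, and the bracket defined in the context) is a graded Lie algebra. Moreover, a linear map $P:M\to A$ is a relative averaging operator if and only if $P\in CY^1(M,A)$ is a Maurer-Cartan element of this graded Lie algebra, i.e. $\llbracket P,P\rrbracket=0$.
   Context: Everything is over a field $\mathbf k$ of characteristic $0$. Associative algebras are not assumed unital. Trees. $Y_n$ ($n\ge 1$) is the set of planar binary trees with $n$ trivalent vertices, one root and $n+1$ leaves labelled $0,1,\dots,n$ from left to right; $Y_0=\{|\}$. For $y_1\in Y_m,y_2\in Y_n$, the grafting $y_1\vee y_2\in Y_{m+n+1}$ joins the roots of $y_1$ (left) and $y_2$ (right) to a new vertex with a new root. $Y_1=\{|\vee|\}$ and $Y_2=\{y_\dashv,y_\vdash\}$, $y_\dashv=|\vee(|\vee|)$, $y_\vdash=(|\vee|)\vee|$. For $m,n\ge1$, $1\le i\le m$: $R_0^{m;i,n}:Y_{m+n-1}\to Y_m$ deletes the leaves labelled $i,\dots,i+n-2$, and $R_i^{m;i,n}:Y_{m+n-1}\to Y_n$ deletes the leaves labelled $0,\dots,i-2$ and $i+n,\dots,m+n-1$ (labels refer to the original tree; deleting a leaf also removes the resulting bivalent vertex). Majumdar-Mukherjee bracket. For vector spaces $D,D'$ put $CY^n(D,D')=\mathrm{Hom}(\mathbf k[Y_n]\otimes D^{\otimes n},D')$.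 For $f\in CY^m(D,D)$, $g\in CY^n(D,D)$, $m,n\geq 1$, $$(f\circ_i g)(y;a_1,\dots,a_{m+n-1})=f\big(R_0^{m;i,n}(y);a_1,\dots,a_{i-1},g(R_i^{m;i,n}(y);a_i,\dots,a_{i+n-1}),a_{i+n},\dots,a_{m+n-1}\big),$$ $$[f,g]_{\mathsf{MM}}=\sum_{i=1}^m(-1)^{(i-1)(n-1)}f\circ_i g-(-1)^{(m-1)(n-1)}\sum_{i=1}^n(-1)^{(i-1)(m-1)}g\circ_i f .$$ Relative averaging operator. A linear map $P:M\to A$ with $P(u)\cdot P(v)=P(P(u)\cdot_M v)=P(u\cdot_M P(v))$ for all $u,v\in M$, where $\cdot_M$ denotes both $A$-actions on $M$. A linear map $P:M\to A$ is identified with the element of $CY^1(M,A)$ given by $P(|\vee|;u)=P(u)$. The bracket $\llbracket\ ,\ \rrbracket$. Let $\Delta\in CY^2(A\oplus M,A\oplus M)$ be $$\Delta(y_\dashv;(a,u),(b,v))=(a\cdot b,u\cdot_M b),\qquad \Delta(y_\vdash;(a,u),(b,v))=(a\cdot b,a\cdot_M v).$$ Regard $CY^n(M,A)\subset CY^n(A\oplus M,A\oplus M)$ ($n\ge1$) by extension by zero. For $f\in CY^m(M,A)$, $g\in CY^n(M,A)$, $m,n\ge1$, set $\llbracket f,g\rrbracket=(-1)^m[[\Delta,f]_{\mathsf{MM}},g]_{\mathsf{MM}}\in CY^{m+n}(M,A)$. For $a,b\in A=CY^0(M,A)$ and $f\in CY^m(M,A)$, $m\ge1$, set $\llbracket a,b\rrbracket=a\cdot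 b-b\cdot a$, $$\llbracket f,a\rrbracket(y;u_1,\dots,u_m)=\sum_{i=1}^m f(y;u_1,\dots,u_{i-1},a\cdot_M u_i-u_i\cdot_M a,u_{i+1},\dots,u_m)+f(y;u_1,\dots,u_m)\cdot a-a\cdot f(y;u_1,\dots,u_m),$$ and $\llbracket a,f\rrbracket=-\llbracket f,a\rrbracket$. *)

theory Defs
  imports Complex_Main "HOL-Library.Function_Algebras" "HOL-Library.Product_Plus"
begin

text \<open>The sign \<open>(-1)\<^sup>k\<close> acting on an abelian group.\<close>

definition signed :: "nat \<Rightarrow> 'v \<Rightarrow> 'v :: ab_group_add" where
  "signed k x = (if even k then x else - x)"


section \<open>Algebras and bimodules\<close>

locale assoc_algebra = vector_space scale
  for scale :: "'k :: field_char_0 \<Rightarrow> 'a :: ab_group_add \<Rightarrow> 'a" +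
  fixes mul :: "'a \<Rightarrow> 'a \<Rightarrow> 'a"
  assumes mul_linear_left: "Vector_Spaces.linear scale scale (\<lambda>a. mul a b)"
    and mul_linear_right: "Vector_Spaces.linear scale scale (\<lambda>b. mul a b)"
    and mul_assoc: "mul (mul a b) c = mul a (mul b c)"

locale alg_bimodule =
  assoc_algebra scaleA mul + M: vector_space scaleM
  for scaleA :: "'k :: field_char_0 \<Rightarrow> 'a :: ab_group_add \<Rightarrow> 'a"
    and mul :: "'a \<Rightarrow> 'a \<Rightarrow> 'a"
    and scaleM :: "'k \<Rightarrow> 'm :: ab_group_add \<Rightarrow> 'm" +
  fixes lact :: "'a \<Rightarrow> 'm \<Rightarrow> 'm"
    and ract :: "'m \<Rightarrow> 'a \<Rightarrow> 'm"
  assumes lact_linear_left: "Vector_Spaces.linear scaleA scaleM (\<lambda>a. lact a u)"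
    and lact_linear_right: "Vector_Spaces.linear scaleM scaleM (\<lambda>u. lact a u)"
    and ract_linear_left: "Vector_Spaces.linear scaleM scaleM (\<lambda>u. ract u a)"
    and ract_linear_right: "Vector_Spaces.linear scaleA scaleM (\<lambda>a. ract u a)"
    and lact_mul: "lact (mul a b) u = lact a (lact b u)"
    and ract_mul: "ract u (mul a b) = ract (ract u a) b"
    and lact_ract: "ract (lact a u) b = lact a (ract u b)"

definition relative_averaging_operator ::
  "('k :: field_char_0 \<Rightarrow> 'a :: ab_group_add \<Rightarrow> 'a) \<Rightarrow> ('a \<Rightarrow> 'a \<Rightarrow> 'a) \<Rightarrow>
   ('k \<Rightarrow> 'm :: ab_group_add \<Rightarrow> 'm) \<Rightarrow> ('a \<Rightarrow> 'm \<Rightarrow> 'm) \<Rightarrow> ('m \<Rightarrow> 'a \<Rightarrow> 'm) \<Rightarrow>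
   ('m \<Rightarrow> 'a) \<Rightarrow> bool" where
  "relative_averaging_operator scaleA mul scaleM lact ract P \<longleftrightarrow>
     Vector_Spaces.linear scaleM scaleA P \<and>
     (\<forall>u v. mul (P u) (P v) = P (lact (P u) v) \<and> P (lact (P u) v) = P (ract u (P v)))"


section \<open>Graded Lie algebras\<close>

text \<open>
  The underlying space is the internal direct sum of the subspaces \<open>L n\<close>, i.e. the span
  of their union; nothing is required of the bracket outside that span.
\<close>

locale graded_Lie_algebra = vector_space scale
  for scale :: "'k :: field_char_0 \<Rightarrow> 'v :: ab_group_add \<Rightarrow> 'v" +
  fixes L :: "nat \<Rightarrow> 'v set"
    and br :: "'v \<Rightarrow> 'v \<Rightarrow> 'v"
  assumes subspace_L: "subspace (L n)"
    and direct: "finite N \<Longrightarrow> (\<And>n. n \<in> N \<Longrightarrow> x n \<in> L n) \<Longrightarrow> (\<Sum>n\<in>N. x n) = 0 \<Longrightarrow>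
                   n \<in> N \<Longrightarrow> x n = 0"
    and br_add_left: "\<lbrakk>a \<in> span (\<Union>n. L n); b \<in> span (\<Union>n. L n); c \<in> span (\<Union>n. L n)\<rbrakk> \<Longrightarrow>
                        br (a + b) c = br a c + br b c"
    and br_add_right: "\<lbrakk>a \<in> span (\<Union>n. L n); b \<in> span (\<Union>n. L n); c \<in> span (\<Union>n. L n)\<rbrakk> \<Longrightarrow>
                        br a (b + c) = br a b + br a c"
    and br_scale_left: "\<lbrakk>a \<in> span (\<Union>n. L n); b \<in> span (\<Union>n. L n)\<rbrakk> \<Longrightarrow>
                        br (scale r a) b = scale r (br a b)"
    and br_scale_right: "\<lbrakk>a \<in> span (\<Union>n. L n); b \<in> span (\<Union>n. L n)\<rbrakk> \<Longrightarrow>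
                        br a (scale r b) = scale r (br a b)"
    and br_degree: "\<lbrakk>a \<in> L p; b \<in> L q\<rbrakk> \<Longrightarrow> br a b \<in> L (p + q)"
    and br_skew: "\<lbrakk>a \<in> L p; b \<in> L q\<rbrakk> \<Longrightarrow> br a b = - signed (p * q) (br b a)"
    and br_Jacobi: "\<lbrakk>a \<in> L p; b \<in> L q; c \<in> L r'\<rbrakk> \<Longrightarrow>
                      br a (br b c) = br (br a b) c + signed (p * q) (br b (br a c))"

definition Maurer_Cartan :: "(nat \<Rightarrow> 'v set) \<Rightarrow> ('v \<Rightarrow> 'v \<Rightarrow> 'v :: zero) \<Rightarrow> 'v \<Rightarrow> bool" where
  "Maurer_Cartan L br x \<longleftrightarrow> x \<in> L 1 \<and> br x x = 0"


section \<open>Planar binary trees\<close>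

datatype pbtree = Leaf | Graft pbtree pbtree

fun vertices :: "pbtree \<Rightarrow> nat" where
  "vertices Leaf = 0"
| "vertices (Graft l r) = vertices l + vertices r + 1"

definition Y :: "nat \<Rightarrow> pbtree set" where
  "Y n = {y. vertices y = n}"

definition y_one :: pbtree where "y_one = Graft Leaf Leaf"
definition y_dashv :: pbtree where "y_dashv = Graft Leaf (Graft Leaf Leaf)"
definition y_vdash :: pbtree where "y_vdash = Graft (Graft Leaf Leaf) Leaf"

text \<open>
  \<open>prune S k y\<close> deletes from \<open>y\<close> all leaves whose label is in \<open>S\<close>, where the leaves of \<open>y\<close>
  are labelled \<open>k, k + 1, \<dots>\<close> from left to right, and suppresses the resulting bivalent
  vertices; the result is \<open>None\<close> iff every leaf is deleted.
\<close>

fun prune :: "nat set \<Rightarrow> nat \<Rightarrow> pbtree \<Rightarrow> pbtree option" where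
  "prune S k Leaf = (if k \<in> S then None else Some Leaf)"
| "prune S k (Graft l r) =
     (case (prune S k l, prune S (k + vertices l + 1) r) of
        (Some l', Some r') \<Rightarrow> Some (Graft l' r')
      | (Some l', None) \<Rightarrow> Some l'
      | (None, r') \<Rightarrow> r')"

definition delete_leaves :: "nat set \<Rightarrow> pbtree \<Rightarrow> pbtree" where
  "delete_leaves S y = the (prune S 0 y)"

text \<open>
  \<open>R_outer m i n\<close> is \<open>R\<^sub>0\<close> and \<open>R_inner m i n\<close> is \<open>R\<^sub>i\<close>. Half-open
  intervals avoid truncated subtraction in \<open>i + n - 2\<close> and \<open>i - 2\<close>.
\<close>

definition R_outer :: "nat \<Rightarrow> nat \<Rightarrow> nat \<Rightarrow> pbtree \<Rightarrow> pbtree" where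
  "R_outer m i n y = delete_leaves {i..<i + n - 1} y"

definition R_inner :: "nat \<Rightarrow> nat \<Rightarrow> nat \<Rightarrow> pbtree \<Rightarrow> pbtree" where
  "R_inner m i n y = delete_leaves ({..<i - 1} \<union> {i + n..m + n - 1}) y"


section \<open>Cochains and the Majumdar-Mukherjee bracket\<close>

text \<open>
  A linear map from \<open>k[Y\<^sub>n] \<otimes> D\<^sup>\<otimes>\<^sup>n\<close> to \<open>D'\<close> is a family, indexed by the trees in
  \<open>Y n\<close>, of maps on lists of length \<open>n\<close> that are linear in each entry. It is extended by
  \<open>0\<close> to all other trees and lists, so that the \<open>CY n\<close> are independent subspaces of one
  function space, with pointwise operations.
\<close>

type_synonym ('d, 'e) cochain = "pbtree \<Rightarrow> 'd list \<Rightarrow> 'e"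

definition scale_cochain :: "('k \<Rightarrow> 'e \<Rightarrow> 'e) \<Rightarrow> 'k \<Rightarrow> ('d, 'e) cochain \<Rightarrow> ('d, 'e) cochain" where
  "scale_cochain s c f = (\<lambda>y xs. s c (f y xs))"

definition CY ::
  "('k :: field \<Rightarrow> 'd :: ab_group_add \<Rightarrow> 'd) \<Rightarrow> ('k \<Rightarrow> 'e :: ab_group_add \<Rightarrow> 'e) \<Rightarrow>
   nat \<Rightarrow> ('d, 'e) cochain set" where
  "CY s s' n =
     {f. (\<forall>y xs. \<not> (y \<in> Y n \<and> length xs = n) \<longrightarrow> f y xs = 0) \<and>
         (\<forall>y\<in>Y n. \<forall>xs. length xs = n \<longrightarrow>
            (\<forall>i<n. Vector_Spaces.linear s s' (\<lambda>x. f y (xs[i := x]))))}"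

definition circ ::
  "nat \<Rightarrow> nat \<Rightarrow> nat \<Rightarrow> ('d, 'd) cochain \<Rightarrow> ('d, 'd) cochain \<Rightarrow> ('d :: zero, 'd) cochain" where
  "circ m n i f g = (\<lambda>y xs.
     if y \<in> Y (m + n - 1) \<and> length xs = m + n - 1
     then f (R_outer m i n y)
            (take (i - 1) xs @ [g (R_inner m i n y) (take n (drop (i - 1) xs))] @
             drop (i - 1 + n) xs)
     else 0)"

definition MM_bracket ::
  "nat \<Rightarrow> nat \<Rightarrow> ('d, 'd) cochain \<Rightarrow> ('d, 'd) cochain \<Rightarrow> ('d :: ab_group_add, 'd) cochain" where
  "MM_bracket m n f g =
     (\<Sum>i=1..m. signed ((i - 1) * (n - 1)) (circ m n i f g)) -
     signed ((m - 1) * (n - 1)) (\<Sum>i=1..n. signed ((i - 1) * (m - 1)) (circ n m i g f))"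


section \<open>The bracket on \<open>CY(M, A)\<close>\<close>

definition Delta ::
  "('a \<Rightarrow> 'a \<Rightarrow> 'a) \<Rightarrow> ('a \<Rightarrow> 'm \<Rightarrow> 'm) \<Rightarrow> ('m \<Rightarrow> 'a \<Rightarrow> 'm) \<Rightarrow>
   ('a :: ab_group_add \<times> 'm :: ab_group_add, 'a \<times> 'm) cochain" where
  "Delta mul lact ract y xs =
     (case xs of
        [(a, u), (b, v)] \<Rightarrow>
          (if y = y_dashv then (mul a b, ract u b)
           else if y = y_vdash then (mul a b, lact a v) else 0)
      | _ \<Rightarrow> 0)"

definition extend_zero :: "('m, 'a) cochain \<Rightarrow> ('a \<times> 'm, 'a \<times> 'm :: zero) cochain" where
  "extend_zero f = (\<lambda>y xs. (f y (map snd xs), 0))"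

text \<open>Elements of \<open>A\<close> as cochains of degree \<open>0\<close>, and maps \<open>M \<rightarrow> A\<close> as cochains of degree \<open>1\<close>.\<close>

definition cochain0 :: "'a \<Rightarrow> ('m, 'a :: zero) cochain" where
  "cochain0 a = (\<lambda>y xs. if y = Leaf \<and> xs = [] then a else 0)"

definition cochain1 :: "('m \<Rightarrow> 'a) \<Rightarrow> ('m, 'a :: zero) cochain" where
  "cochain1 P = (\<lambda>y xs. if y = y_one \<and> length xs = 1 then P (hd xs) else 0)"

definition bracket_pos ::
  "('k :: field_char_0 \<Rightarrow> 'a :: ab_group_add \<Rightarrow> 'a) \<Rightarrow> ('a \<Rightarrow> 'a \<Rightarrow> 'a) \<Rightarrow>
   ('k \<Rightarrow> 'm :: ab_group_add \<Rightarrow> 'm) \<Rightarrow> ('a \<Rightarrow> 'm \<Rightarrow> 'm) \<Rightarrow> ('m \<Rightarrow> 'a \<Rightarrow> 'm) \<Rightarrow>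
   nat \<Rightarrow> nat \<Rightarrow> ('m, 'a) cochain \<Rightarrow> ('m, 'a) cochain \<Rightarrow> ('m, 'a) cochain" where
  "bracket_pos scaleA mul scaleM lact ract m n f g =
     (THE h. h \<in> CY scaleM scaleA (m + n) \<and>
        extend_zero h =
          signed m (MM_bracket (m + 1) n
                      (MM_bracket 2 m (Delta mul lact ract) (extend_zero f))
                      (extend_zero g)))"

definition bracket_elem ::
  "('a \<Rightarrow> 'a \<Rightarrow> 'a) \<Rightarrow> ('a \<Rightarrow> 'm \<Rightarrow> 'm) \<Rightarrow> ('m \<Rightarrow> 'a \<Rightarrow> 'm) \<Rightarrow>
   nat \<Rightarrow> ('m :: ab_group_add, 'a :: ab_group_add) cochain \<Rightarrow> 'a \<Rightarrow> ('m, 'a) cochain" where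
  "bracket_elem mul lact ract m f a = (\<lambda>y us.
     (\<Sum>i<m. f y (us[i := lact a (us ! i) - ract (us ! i) a])) +
     mul (f y us) a - mul a (f y us))"

definition bracket_hom ::
  "('k :: field_char_0 \<Rightarrow> 'a :: ab_group_add \<Rightarrow> 'a) \<Rightarrow> ('a \<Rightarrow> 'a \<Rightarrow> 'a) \<Rightarrow>
   ('k \<Rightarrow> 'm :: ab_group_add \<Rightarrow> 'm) \<Rightarrow> ('a \<Rightarrow> 'm \<Rightarrow> 'm) \<Rightarrow> ('m \<Rightarrow> 'a \<Rightarrow> 'm) \<Rightarrow>
   nat \<Rightarrow> nat \<Rightarrow> ('m, 'a) cochain \<Rightarrow> ('m, 'a) cochain \<Rightarrow> ('m, 'a) cochain" where
  "bracket_hom scaleA mul scaleM lact ract m n f g =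
     (if m = 0 \<and> n = 0 then
        cochain0 (mul (f Leaf []) (g Leaf []) - mul (g Leaf []) (f Leaf []))
      else if n = 0 then bracket_elem mul lact ract m f (g Leaf [])
      else if m = 0 then - bracket_elem mul lact ract n g (f Leaf [])
      else bracket_pos scaleA mul scaleM lact ract m n f g)"

definition component :: "nat \<Rightarrow> ('d, 'e) cochain \<Rightarrow> ('d, 'e :: zero) cochain" where
  "component n F = (\<lambda>y xs. if y \<in> Y n \<and> length xs = n then F y xs else 0)"

text \<open>
  The bilinear extension to the direct sum, whose elements have only finitely many nonzero
  components.
\<close>

definition bracket ::
  "('k :: field_char_0 \<Rightarrow> 'a :: ab_group_add \<Rightarrow> 'a) \<Rightarrow> ('a \<Rightarrow> 'a \<Rightarrow> 'a) \<Rightarrow>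
   ('k \<Rightarrow> 'm :: ab_group_add \<Rightarrow> 'm) \<Rightarrow> ('a \<Rightarrow> 'm \<Rightarrow> 'm) \<Rightarrow> ('m \<Rightarrow> 'a \<Rightarrow> 'm) \<Rightarrow>
   ('m, 'a) cochain \<Rightarrow> ('m, 'a) cochain \<Rightarrow> ('m, 'a) cochain" where
  "bracket scaleA mul scaleM lact ract F G =
     (\<Sum>m | component m F \<noteq> 0. \<Sum>n | component n G \<noteq> 0.
        bracket_hom scaleA mul scaleM lact ract m n (component m F) (component n G))"

end

theory Submission
  imports Defs
begin

text \<open>
  Under the Majumdar-Mukherjee bracket, the cochains of \<open>D = A \<oplus> M\<close> form the graded Lie
  algebra of a nonsymmetric operad, in which \<open>\<Delta>\<close> squares to zero, because it is a dialgebra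
  structure, and the cochains from \<open>M\<close> to \<open>A\<close> commute. So the bracket of the theorem is a
  derived bracket in positive degrees.
  To include degree \<open>0\<close>, let \<open>f\<close> of degree \<open>p \<ge> 1\<close> act by \<open>\<Theta> f = (-1)\<^sup>p [\<Delta>, f]\<close> and \<open>a \<in> A\<close> by
  the derivation \<open>\<Theta> a\<close> of \<open>D\<close> given by the commutator with \<open>a\<close>; all these commute with \<open>\<Delta>\<close>. Then
  \<open>\<lbrakk>f, g\<rbrakk> = [\<Theta> f, g]\<close> for \<open>g\<close> of positive degree and \<open>\<Theta> \<lbrakk>f, g\<rbrakk> = [\<Theta> f, \<Theta> g]\<close> throughout, so that the
  Jacobi identity is inherited. Finally \<open>\<lbrakk>P, P\<rbrakk> = 0\<close> unfolds on the two trees of \<open>Y\<^sub>2\<close> to twice the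
  two identities of a relative averaging operator.
\<close>

section \<open>Calculus of signs\<close>

lemma signed_0 [simp]: "signed 0 x = x"
  by (simp add: signed_def)

lemma signed_zero [simp]: "signed k 0 = 0"
  by (simp add: signed_def)

lemma signed_add: "signed k (x + y) = signed k x + signed k y"
  by (simp add: signed_def)

lemma signed_diff: "signed k (x - y) = signed k x - signed k y"
  by (simp add: signed_def)

lemma signed_minus: "signed k (- x) = - signed k x"
  by (simp add: signed_def)

lemma signed_signed: "signed j (signed k x) = signed (j + k) x"
  by (simp add: signed_def)

lemma signed_sum: "signed k (\<Sum>x\<in>A. f x) = (\<Sum>x\<in>A. signed k (f x))"
  by (simp add: signed_def sum_negf)

lemma (in vector_space) scale_signed: "scale c (signed k x) = signed k (scale c x)"
  by (simp add: signed_def)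

lemma (in vector_space) subspace_signed: "subspace S \<Longrightarrow> x \<in> S \<Longrightarrow> signed k x \<in> S"
  by (simp add: signed_def subspace_neg)

section \<open>The Gerstenhaber bracket of a nonsymmetric operad\<close>

text \<open>
  \<open>C d\<close> holds the operations of arity \<open>d + 1\<close>, and \<open>pc d e i\<close> inserts into the input with
  number \<open>i\<close>, counted from \<open>0\<close>. With these shifted degrees all signs add up without
  truncated subtraction.
\<close>

locale ns_operad = vector_space scale
  for scale :: "'k :: field_char_0 \<Rightarrow> 'v :: ab_group_add \<Rightarrow> 'v" +
  fixes C :: "nat \<Rightarrow> 'v set"
    and pc :: "nat \<Rightarrow> nat \<Rightarrow> nat \<Rightarrow> 'v \<Rightarrow> 'v \<Rightarrow> 'v"
  assumes subspace_C: "subspace (C d)"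
    and pc_closed: "\<lbrakk>i \<le> d; f \<in> C d; g \<in> C e\<rbrakk> \<Longrightarrow> pc d e i f g \<in> C (d + e)"
    and pc_add_left: "pc d e i (f + f') g = pc d e i f g + pc d e i f' g"
    and pc_scale_left: "pc d e i (scale c f) g = scale c (pc d e i f g)"
    and pc_add_right: "\<lbrakk>i \<le> d; f \<in> C d; g \<in> C e; g' \<in> C e\<rbrakk> \<Longrightarrow>
                         pc d e i f (g + g') = pc d e i f g + pc d e i f g'"
    and pc_scale_right: "\<lbrakk>i \<le> d; f \<in> C d; g \<in> C e\<rbrakk> \<Longrightarrow>
                           pc d e i f (scale c g) = scale c (pc d e i f g)"
    and pc_sequential: "\<lbrakk>i \<le> d; j \<le> e; f \<in> C d; g \<in> C e; h \<in> C p\<rbrakk> \<Longrightarrow>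
                          pc (d + e) p (i + j) (pc d e i f g) h = pc d (e + p) i f (pc e p j g h)"
    and pc_parallel: "\<lbrakk>i < l; l \<le> d; f \<in> C d; g \<in> C e; h \<in> C p\<rbrakk> \<Longrightarrow>
                        pc (d + e) p (l + e) (pc d e i f g) h = pc (d + p) e i (pc d p l f h) g"
begin

lemma pc_zero_left [simp]: "pc d e i 0 g = 0"
  using pc_scale_left[of d e i 0 0 g] by simp

lemma pc_signed_left: "pc d e i (signed k f) g = signed k (pc d e i f g)"
  using pc_scale_left[of d e i "-1" f g] by (simp add: signed_def)

lemma pc_sum_left: "pc d e i (\<Sum>x\<in>A. f x) g = (\<Sum>x\<in>A. pc d e i (f x) g)"
  by (induction A rule: infinite_finite_induct) (simp_all add: pc_add_left)

lemma pc_zero_right: "\<lbrakk>i \<le> d; f \<in> C d\<rbrakk> \<Longrightarrow> pc d e i f 0 = 0"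
  using pc_scale_right[of i d f 0 e 0] subspace_0[OF subspace_C] by simp

lemma pc_signed_right:
  "\<lbrakk>i \<le> d; f \<in> C d; g \<in> C e\<rbrakk> \<Longrightarrow> pc d e i f (signed k g) = signed k (pc d e i f g)"
  using pc_scale_right[of i d f g e "-1"] by (simp add: signed_def)

lemma pc_sum_right:
  "\<lbrakk>i \<le> d; f \<in> C d; \<And>x. x \<in> A \<Longrightarrow> g x \<in> C e\<rbrakk> \<Longrightarrow>
     pc d e i f (\<Sum>x\<in>A. g x) = (\<Sum>x\<in>A. pc d e i f (g x))"
  by (induction A rule: infinite_finite_induct)
    (simp_all add: pc_add_right pc_zero_right subspace_sum[OF subspace_C])

text \<open>Gerstenhaber's pre-Lie product: inserting \<open>g\<close>, of degree \<open>e\<close>,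
  at input \<open>i\<close> moves it past \<open>i\<close> inputs, hence the sign.\<close>

definition pl :: "nat \<Rightarrow> nat \<Rightarrow> 'v \<Rightarrow> 'v \<Rightarrow> 'v" where
  "pl d e f g = (\<Sum>i\<le>d. signed (i * e) (pc d e i f g))"

text \<open>The graded commutator of \<open>pl\<close>, that is, the Gerstenhaber bracket in degrees
  arity minus one.\<close>

definition lb :: "nat \<Rightarrow> nat \<Rightarrow> 'v \<Rightarrow> 'v \<Rightarrow> 'v" where
  "lb d e f g = pl d e f g - signed (d * e) (pl e d g f)"

lemma pl_closed: "\<lbrakk>f \<in> C d; g \<in> C e\<rbrakk> \<Longrightarrow> pl d e f g \<in> C (d + e)"
  unfolding pl_def by (intro subspace_sum subspace_signed pc_closed subspace_C) auto

lemma pl_add_left: "pl d e (f + f') g = pl d e f g + pl d e f' g"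
  by (simp add: pl_def pc_add_left signed_add sum.distrib)

lemma pl_scale_left: "pl d e (scale c f) g = scale c (pl d e f g)"
  by (simp add: pl_def pc_scale_left scale_sum_right scale_signed)

lemma pl_add_right:
  "\<lbrakk>f \<in> C d; g \<in> C e; g' \<in> C e\<rbrakk> \<Longrightarrow> pl d e f (g + g') = pl d e f g + pl d e f g'"
  by (simp add: pl_def pc_add_right signed_add sum.distrib)

lemma pl_scale_right:
  "\<lbrakk>f \<in> C d; g \<in> C e\<rbrakk> \<Longrightarrow> pl d e f (scale c g) = scale c (pl d e f g)"
  by (simp add: pl_def pc_scale_right scale_sum_right scale_signed)

lemma pl_minus_left: "pl d e (- f) g = - pl d e f g"
  using pl_scale_left[of d e "-1" f g] by simp

lemma pl_minus_right: "\<lbrakk>f \<in> C d; g \<in> C e\<rbrakk> \<Longrightarrow> pl d e f (- g) = - pl d e f g"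
  using pl_scale_right[of f d g e "-1"] by simp

lemma pl_diff_left: "pl d e (f - f') g = pl d e f g - pl d e f' g"
  using pl_add_left[of d e f "- f'" g] by (simp add: pl_minus_left)

lemma pl_diff_right:
  "\<lbrakk>f \<in> C d; g \<in> C e; g' \<in> C e\<rbrakk> \<Longrightarrow> pl d e f (g - g') = pl d e f g - pl d e f g'"
  using pl_add_right[of f d g e "- g'"] by (simp add: pl_minus_right subspace_neg[OF subspace_C])

lemma lb_closed: "\<lbrakk>f \<in> C d; g \<in> C e\<rbrakk> \<Longrightarrow> lb d e f g \<in> C (d + e)"
  unfolding lb_def using pl_closed[of f d g e] pl_closed[of g e f d]
  by (simp add: add.commute subspace_diff subspace_signed subspace_C)

lemma lb_add_left:
  "\<lbrakk>f \<in> C d; f' \<in> C d; g \<in> C e\<rbrakk> \<Longrightarrow> lb d e (f + f') g = lb d e f g + lb d e f' g"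
  by (simp add: lb_def pl_add_left pl_add_right signed_add)

lemma lb_add_right:
  "\<lbrakk>f \<in> C d; g \<in> C e; g' \<in> C e\<rbrakk> \<Longrightarrow> lb d e f (g + g') = lb d e f g + lb d e f g'"
  by (simp add: lb_def pl_add_left pl_add_right signed_add)

lemma lb_scale_left:
  "\<lbrakk>f \<in> C d; g \<in> C e\<rbrakk> \<Longrightarrow> lb d e (scale c f) g = scale c (lb d e f g)"
  by (simp add: lb_def pl_scale_left pl_scale_right scale_right_diff_distrib scale_signed)

lemma lb_scale_right:
  "\<lbrakk>f \<in> C d; g \<in> C e\<rbrakk> \<Longrightarrow> lb d e f (scale c g) = scale c (lb d e f g)"
  by (simp add: lb_def pl_scale_left pl_scale_right scale_right_diff_distrib scale_signed)

lemma lb_signed_left: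
  "\<lbrakk>f \<in> C d; g \<in> C e\<rbrakk> \<Longrightarrow> lb d e (signed k f) g = signed k (lb d e f g)"
  using lb_scale_left[of f d g e "-1"] by (simp add: signed_def)

lemma lb_signed_right:
  "\<lbrakk>f \<in> C d; g \<in> C e\<rbrakk> \<Longrightarrow> lb d e f (signed k g) = signed k (lb d e f g)"
  using lb_scale_right[of f d g e "-1"] by (simp add: signed_def)

lemma lb_zero_left: "g \<in> C e \<Longrightarrow> lb d e 0 g = 0"
  using lb_scale_left[of 0 d g e 0] subspace_0[OF subspace_C] by simp

lemma lb_zero_right: "f \<in> C d \<Longrightarrow> lb d e f 0 = 0"
  using lb_scale_right[of f d 0 e 0] subspace_0[OF subspace_C] by simp

lemma lb_skew: "lb e d g f = - signed (d * e) (lb d e f g)"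
  by (simp add: lb_def signed_diff signed_signed mult.commute) (simp add: signed_def)

text \<open>The part of the associator in which the second insertion lands to the left of the first.\<close>

definition left_part :: "nat \<Rightarrow> nat \<Rightarrow> nat \<Rightarrow> 'v \<Rightarrow> 'v \<Rightarrow> 'v \<Rightarrow> 'v" where
  "left_part d e p f g h =
     (\<Sum>i\<le>d. \<Sum>k<i. signed (i * e + k * p) (pc (d + e) p k (pc d e i f g) h))"

text \<open>Once an operation of degree \<open>e\<close> sits at input \<open>i\<close>, the inputs
  of the composite fall into three ranges: to its left, its own, and to its right. In the last range
  \<open>l\<close> numbers an input of the outer operation, shifted by \<open>e\<close>.\<close>

lemma sum_split_insertion:
  fixes t :: "nat \<Rightarrow> 'b :: comm_monoid_add"
  assumes "i \<le> d"
  shows "(\<Sum>k\<le>d + e. t k) = (\<Sum>k<i. t k) + (\<Sum>j\<le>e. t (i + j)) + (\<Sum>l=Suc i..d. t (l + e))"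
proof -
  have "(\<Sum>j\<le>e. t (i + j)) = sum t {i..i + e}"
    using sum.shift_bounds_cl_nat_ivl[of t 0 i e] by (simp add: atLeast0AtMost add.commute)
  moreover have "(\<Sum>l=Suc i..d. t (l + e)) = sum t {Suc i + e..d + e}"
    by (rule sum.shift_bounds_cl_nat_ivl[symmetric])
  moreover have "{..d + e} = {..<i} \<union> {i..i + e} \<union> {Suc i + e..d + e}"
    using assms by auto
  moreover have "sum t ({..<i} \<union> {i..i + e} \<union> {Suc i + e..d + e}) =
      sum t {..<i} + sum t {i..i + e} + sum t {Suc i + e..d + e}"
    by (subst sum.union_disjoint; (subst sum.union_disjoint)?) auto
  ultimately show ?thesis by metis
qed

text \<open>The right-hand side minus its first summand is graded symmetric in \<open>g\<close> and \<open>h\<close>.\<close>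

lemma pl_associator:
  assumes f: "f \<in> C d" and g: "g \<in> C e" and h: "h \<in> C p"
  shows "pl (d + e) p (pl d e f g) h =
    pl d (e + p) f (pl e p g h) + left_part d e p f g h + signed (e * p) (left_part d p e f h g)"
proof -
  define t where "t i k = signed (i * e + k * p) (pc (d + e) p k (pc d e i f g) h)" for i k
  have "pl (d + e) p (pl d e f g) h = (\<Sum>k\<le>d + e. \<Sum>i\<le>d. t i k)"
    unfolding pl_def t_def
    by (simp add: pc_sum_left pc_signed_left signed_sum signed_signed add.commute)
  also have "\<dots> = (\<Sum>i\<le>d. \<Sum>k\<le>d + e. t i k)"
    by (rule sum.swap)
  also have "\<dots> = (\<Sum>i\<le>d. (\<Sum>k<i. t i k) + (\<Sum>j\<le>e. t i (i + j)) + (\<Sum>l=Suc i..d. t i (l + e)))"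
    by (intro sum.cong refl sum_split_insertion) simp
  also have "\<dots> = left_part d e p f g h + (\<Sum>i\<le>d. \<Sum>j\<le>e. t i (i + j)) +
      (\<Sum>i\<le>d. \<Sum>l=Suc i..d. t i (l + e))"
    by (simp add: sum.distrib left_part_def t_def)
  \<comment> \<open>Middle range: \<open>h\<close> is inserted into \<open>g\<close> itself, and the
    sequential axiom lets this be done before inserting into \<open>f\<close>.\<close>
  also have "(\<Sum>i\<le>d. \<Sum>j\<le>e. t i (i + j)) = pl d (e + p) f (pl e p g h)"
  proof -
    have "pc d (e + p) i f (pl e p g h) = (\<Sum>j\<le>e. signed (j * p) (pc d (e + p) i f (pc e p j g h)))"
      if "i \<le> d" for i
      unfolding pl_def using that f g h
      by (subst pc_sum_right) (auto simp: pc_signed_right pc_closed subspace_signed subspace_C)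
    then show ?thesis
      unfolding pl_def[of d] t_def using f g h
      by (intro sum.cong refl)
        (simp add: signed_sum signed_signed pc_sequential algebra_simps)
  qed
  \<comment> \<open>Right range: summing over pairs \<open>i < l\<close> with \<open>l\<close>
    outermost, the parallel axiom exchanges the two insertions and yields a left part with
    \<open>g\<close> and \<open>h\<close> swapped.\<close>
  also have "(\<Sum>i\<le>d. \<Sum>l=Suc i..d. t i (l + e)) = (\<Sum>l\<le>d. \<Sum>i<l. t i (l + e))"
    by (subst sum.nested_swap') (simp flip: lessThan_Suc_atMost)
  also have "\<dots> = signed (e * p) (left_part d p e f h g)"
    unfolding left_part_def t_def using f g h
    by (simp add: signed_sum signed_signed pc_parallel algebra_simps)
  finally show ?thesis by (simp add: algebra_simps)
qed

text \<open>The associator of \<open>pl\<close> is graded symmetric in its last two arguments, so in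
  the signed sum over the six orders of \<open>f\<close>, \<open>g\<close>, \<open>h\<close> all
  left parts cancel in pairs.\<close>

theorem lb_Jacobi:
  assumes f: "f \<in> C d" and g: "g \<in> C e" and h: "h \<in> C p"
  shows "lb d (e + p) f (lb e p g h) =
    lb (d + e) p (lb d e f g) h + signed (d * e) (lb e (d + p) g (lb d p f h))"
proof -
  \<comment> \<open>These fixed instances give every sum of two of the degrees a single normal form,
    without looping.\<close>
  note sort = add.commute[of e d] add.commute[of p d] add.commute[of p e]
  note closed = pl_closed[OF f g] pl_closed[OF g f, unfolded sort]
    pl_closed[OF f h] pl_closed[OF h f, unfolded sort]
    pl_closed[OF g h] pl_closed[OF h g, unfolded sort]
  note assoc = pl_associator[OF f g h] pl_associator[OF f h g, unfolded sort]
    pl_associator[OF g f h, unfolded sort] pl_associator[OF g h f, unfolded sort]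
    pl_associator[OF h f g, unfolded sort] pl_associator[OF h g f, unfolded sort]
  \<comment> \<open>Fixing the three parities makes every sign explicit, so that only the
    cancellation of equal terms remains.\<close>
  have "lb d (e + p) f (lb e p g h) - lb (d + e) p (lb d e f g) h
      - signed (d * e) (lb e (d + p) g (lb d p f h)) = 0"
    using f g h closed
    by (cases "even d"; cases "even e"; cases "even p")
      (simp_all add: lb_def pl_diff_left pl_diff_right pl_add_left pl_add_right
        pl_minus_left pl_minus_right signed_def assoc sort)
  then show ?thesis by (simp add: algebra_simps)
qed

end

section \<open>Deleting leaves\<close>

lemma prune_cong:
  "(\<And>l. k \<le> l \<Longrightarrow> l \<le> k + vertices y \<Longrightarrow> l \<in> S \<longleftrightarrow> l \<in> S') \<Longrightarrow> prune S k y = prune S' k y"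
proof (induction y arbitrary: k)
  case (Graft l r)
  have "prune S k l = prune S' k l"
    by (rule Graft.IH(1)) (use Graft.prems in auto)
  moreover have "prune S (k + vertices l + 1) r = prune S' (k + vertices l + 1) r"
    by (rule Graft.IH(2)) (use Graft.prems in auto)
  ultimately show ?case by simp
qed auto

text \<open>Here \<open>\<rho>\<close> counts surviving leaves, so a leaf \<open>l \<notin> T\<close> gets the label \<open>\<rho> l\<close>.\<close>

lemma prune_rank:
  assumes "\<And>l. k \<le> l \<Longrightarrow> l \<le> k + vertices y \<Longrightarrow> \<rho> (Suc l) = (if l \<in> T then \<rho> l else Suc (\<rho> l))"
  shows "\<rho> (Suc (k + vertices y)) =
           (case prune T k y of None \<Rightarrow> \<rho> k | Some y' \<Rightarrow> Suc (\<rho> k + vertices y'))"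
  using assms
proof (induction y arbitrary: k)
  case (Graft l r)
  have "\<rho> (Suc (k + vertices l)) =
      (case prune T k l of None \<Rightarrow> \<rho> k | Some y' \<Rightarrow> Suc (\<rho> k + vertices y'))"
    by (rule Graft.IH(1)) (use Graft.prems in auto)
  moreover have "\<rho> (Suc (k + vertices l + 1 + vertices r)) =
      (case prune T (k + vertices l + 1) r of None \<Rightarrow> \<rho> (k + vertices l + 1)
       | Some y' \<Rightarrow> Suc (\<rho> (k + vertices l + 1) + vertices y'))"
    by (rule Graft.IH(2)) (use Graft.prems in auto)
  ultimately show ?case
    by (auto split: option.splits simp: add.assoc)
qed auto

text \<open>A surviving leaf \<open>l\<close> is renamed to \<open>\<rho> l\<close>, so deleting
  \<open>S\<close> from the pruned tree deletes the preimage of \<open>S\<close> from the original.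
  \<open>Option.bind\<close> covers the case that nothing survives the first deletion.\<close>

lemma prune_prune:
  assumes "\<And>l. k \<le> l \<Longrightarrow> l \<le> k + vertices y \<Longrightarrow> \<rho> (Suc l) = (if l \<in> T then \<rho> l else Suc (\<rho> l))"
  shows "Option.bind (prune T k y) (prune S (\<rho> k)) = prune (T \<union> {l. \<rho> l \<in> S}) k y"
  using assms
proof (induction y arbitrary: k)
  case (Graft l r)
  have l: "Option.bind (prune T k l) (prune S (\<rho> k)) = prune (T \<union> {l. \<rho> l \<in> S}) k l"
    by (rule Graft.IH(1)) (use Graft.prems in auto)
  have r: "Option.bind (prune T (k + vertices l + 1) r) (prune S (\<rho> (k + vertices l + 1))) =
      prune (T \<union> {l. \<rho> l \<in> S}) (k + vertices l + 1) r"
    by (rule Graft.IH(2)) (use Graft.prems in auto)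
  \<comment> \<open>This is the label at which the right subtree starts after pruning: it stays
    \<open>\<rho> k\<close> if the left subtree vanishes.\<close>
  have "\<rho> (Suc (k + vertices l)) =
      (case prune T k l of None \<Rightarrow> \<rho> k | Some y' \<Rightarrow> Suc (\<rho> k + vertices y'))"
    by (rule prune_rank) (use Graft.prems in auto)
  then show ?case
    unfolding prune.simps l[symmetric] r[symmetric]
    by (auto split: option.splits simp: add.assoc)
qed auto

lemma delete_leaves_cong:
  "(\<And>l. l \<le> vertices y \<Longrightarrow> l \<in> S \<longleftrightarrow> l \<in> S') \<Longrightarrow> delete_leaves S y = delete_leaves S' y"
  unfolding delete_leaves_def by (subst prune_cong) auto

text \<open>Since \<open>\<rho>\<close> starts at 0 and counts survivors, its value past the last
  leaf is the number of surviving leaves. Being \<open>Suc M\<close>, it excludes the outcome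
  \<open>None\<close> and gives \<open>M\<close> vertices.\<close>

lemma
  assumes "\<rho> 0 = 0" "\<rho> (Suc (vertices y)) = Suc M"
    and "\<And>l. l \<le> vertices y \<Longrightarrow> \<rho> (Suc l) = (if l \<in> T then \<rho> l else Suc (\<rho> l))"
  shows vertices_delete_leaves: "vertices (delete_leaves T y) = M"
    and delete_leaves_delete_leaves:
      "delete_leaves S (delete_leaves T y) = delete_leaves (T \<union> {l. \<rho> l \<in> S}) y"
proof -
  have "\<rho> (Suc (0 + vertices y)) =
      (case prune T 0 y of None \<Rightarrow> \<rho> 0 | Some y' \<Rightarrow> Suc (\<rho> 0 + vertices y'))"
    by (rule prune_rank) (use assms in auto)
  then obtain y' where y': "prune T 0 y = Some y'" "vertices y' = M"
    using assms by (auto split: option.splits)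
  moreover have "Option.bind (prune T 0 y) (prune S (\<rho> 0)) = prune (T \<union> {l. \<rho> l \<in> S}) 0 y"
    by (rule prune_prune) (use assms in auto)
  ultimately show "vertices (delete_leaves T y) = M"
    "delete_leaves S (delete_leaves T y) = delete_leaves (T \<union> {l. \<rho> l \<in> S}) y"
    using assms by (auto simp: delete_leaves_def)
qed

text \<open>The number of leaves before \<open>l\<close> that survive the deletion of the leaves
  \<open>i + 1\<close> to \<open>i + e\<close>.\<close>

definition outer_rank :: "nat \<Rightarrow> nat \<Rightarrow> nat \<Rightarrow> nat" where
  "outer_rank i e l = (if l \<le> i then l else if l \<le> i + e then Suc i else l - e)"

lemma
  assumes "i \<le> d" "y \<in> Y (Suc (d + e))"
  shows R_outer_in_Y: "R_outer (Suc d) (Suc i) (Suc e) y \<in> Y (Suc d)"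
    and delete_leaves_R_outer: "delete_leaves S (R_outer (Suc d) (Suc i) (Suc e) y) =
      delete_leaves ({Suc i..<Suc i + e} \<union> {l. outer_rank i e l \<in> S}) y"
proof -
  have R: "R_outer (Suc d) (Suc i) (Suc e) y = delete_leaves {Suc i..<Suc i + e} y"
    by (simp add: R_outer_def)
  show "R_outer (Suc d) (Suc i) (Suc e) y \<in> Y (Suc d)"
    unfolding R Y_def mem_Collect_eq using assms
    by (intro vertices_delete_leaves[of "outer_rank i e"]) (auto simp: Y_def outer_rank_def)
  show "delete_leaves S (R_outer (Suc d) (Suc i) (Suc e) y) =
      delete_leaves ({Suc i..<Suc i + e} \<union> {l. outer_rank i e l \<in> S}) y"
    unfolding R using assms
    by (intro delete_leaves_delete_leaves[of _ _ "Suc d"]) (auto simp: Y_def outer_rank_def)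
qed

lemma
  assumes "i \<le> d" "y \<in> Y (Suc (d + e))"
  shows R_inner_in_Y: "R_inner (Suc d) (Suc i) (Suc e) y \<in> Y (Suc e)"
    and delete_leaves_R_inner: "delete_leaves S (R_inner (Suc d) (Suc i) (Suc e) y) =
      delete_leaves ({..<i} \<union> {l. l > Suc (i + e)} \<union> {l. min (l - i) (Suc (Suc e)) \<in> S}) y"
proof -
  \<comment> \<open>The upper interval in \<open>R_inner\<close> ends at the last leaf
    \<open>d + e + 1\<close>, so it may be left unbounded. The kept leaves are \<open>i\<close> to
    \<open>i + e + 1\<close>, and \<open>min (l - i) (Suc (Suc e))\<close> counts those before
    \<open>l\<close>.\<close>
  have R: "R_inner (Suc d) (Suc i) (Suc e) y = delete_leaves ({..<i} \<union> {l. l > Suc (i + e)}) y"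
    unfolding R_inner_def using assms by (intro delete_leaves_cong) (auto simp: Y_def)
  show "R_inner (Suc d) (Suc i) (Suc e) y \<in> Y (Suc e)"
    unfolding R Y_def mem_Collect_eq using assms
    by (intro vertices_delete_leaves[of "\<lambda>l. min (l - i) (Suc (Suc e))"]) (auto simp: Y_def)
  show "delete_leaves S (R_inner (Suc d) (Suc i) (Suc e) y) =
      delete_leaves ({..<i} \<union> {l. l > Suc (i + e)} \<union> {l. min (l - i) (Suc (Suc e)) \<in> S}) y"
    unfolding R using assms
    by (intro delete_leaves_delete_leaves[of _ _ "Suc e"]) (auto simp: Y_def)
qed

text \<open>The tree arguments of \<open>f\<close>, \<open>g\<close> and \<open>h\<close>, in this
  order, in the two nested composites. Each side is a single deletion from \<open>y\<close>, and the
  deleted labels agree up to the last leaf.\<close>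

lemma R_sequential:
  assumes "i \<le> d" "j \<le> e" "y \<in> Y (Suc (d + e + p))"
  shows "R_outer (Suc d) (Suc i) (Suc e) (R_outer (Suc (d + e)) (Suc (i + j)) (Suc p) y) =
      R_outer (Suc d) (Suc i) (Suc (e + p)) y"
    and "R_inner (Suc d) (Suc i) (Suc e) (R_outer (Suc (d + e)) (Suc (i + j)) (Suc p) y) =
      R_outer (Suc e) (Suc j) (Suc p) (R_inner (Suc d) (Suc i) (Suc (e + p)) y)"
    and "R_inner (Suc (d + e)) (Suc (i + j)) (Suc p) y =
      R_inner (Suc e) (Suc j) (Suc p) (R_inner (Suc d) (Suc i) (Suc (e + p)) y)"
proof -
  have y: "y \<in> Y (Suc ((d + e) + p))" "y \<in> Y (Suc (d + (e + p)))" and v: "vertices y = Suc (d + e + p)"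
    using assms by (simp_all add: Y_def algebra_simps)
  have ij: "i + j \<le> d + e"
    using assms by simp
  show "R_outer (Suc d) (Suc i) (Suc e) (R_outer (Suc (d + e)) (Suc (i + j)) (Suc p) y) =
      R_outer (Suc d) (Suc i) (Suc (e + p)) y"
    unfolding R_outer_def[of "Suc d"] delete_leaves_R_outer[OF ij y(1)]
    by (rule delete_leaves_cong) (use assms in \<open>auto simp: outer_rank_def v split: if_splits\<close>)
  show "R_inner (Suc d) (Suc i) (Suc e) (R_outer (Suc (d + e)) (Suc (i + j)) (Suc p) y) =
      R_outer (Suc e) (Suc j) (Suc p) (R_inner (Suc d) (Suc i) (Suc (e + p)) y)"
    unfolding R_inner_def[of "Suc d" _ "Suc e"] R_outer_def[of "Suc e"]
      delete_leaves_R_outer[OF ij y(1)] delete_leaves_R_inner[OF assms(1) y(2)]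
    by (rule delete_leaves_cong) (use assms in \<open>auto simp: outer_rank_def v split: if_splits\<close>)
  show "R_inner (Suc (d + e)) (Suc (i + j)) (Suc p) y =
      R_inner (Suc e) (Suc j) (Suc p) (R_inner (Suc d) (Suc i) (Suc (e + p)) y)"
    unfolding R_inner_def[of "Suc (d + e)"] R_inner_def[of "Suc e"]
      delete_leaves_R_inner[OF assms(1) y(2)]
    by (rule delete_leaves_cong) (use assms in \<open>auto simp: v\<close>)
qed

text \<open>Likewise for insertions of \<open>g\<close> at input \<open>i\<close> and
  \<open>h\<close> at input \<open>l\<close> of \<open>f\<close>, in either order.\<close>

lemma R_parallel:
  assumes "i < l" "l \<le> d" "y \<in> Y (Suc (d + e + p))"
  shows "R_outer (Suc d) (Suc i) (Suc e) (R_outer (Suc (d + e)) (Suc (l + e)) (Suc p) y) =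
      R_outer (Suc d) (Suc l) (Suc p) (R_outer (Suc (d + p)) (Suc i) (Suc e) y)"
    and "R_inner (Suc d) (Suc i) (Suc e) (R_outer (Suc (d + e)) (Suc (l + e)) (Suc p) y) =
      R_inner (Suc (d + p)) (Suc i) (Suc e) y"
    and "R_inner (Suc (d + e)) (Suc (l + e)) (Suc p) y =
      R_inner (Suc d) (Suc l) (Suc p) (R_outer (Suc (d + p)) (Suc i) (Suc e) y)"
proof -
  have y: "y \<in> Y (Suc ((d + e) + p))" "y \<in> Y (Suc ((d + p) + e))" and v: "vertices y = Suc (d + e + p)"
    using assms by (simp_all add: Y_def algebra_simps)
  have le: "l + e \<le> d + e" "i \<le> d + p"
    using assms by simp_all
  show "R_outer (Suc d) (Suc i) (Suc e) (R_outer (Suc (d + e)) (Suc (l + e)) (Suc p) y) =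
      R_outer (Suc d) (Suc l) (Suc p) (R_outer (Suc (d + p)) (Suc i) (Suc e) y)"
    unfolding R_outer_def[of "Suc d"] delete_leaves_R_outer[OF le(1) y(1)]
      delete_leaves_R_outer[OF le(2) y(2)]
    by (rule delete_leaves_cong) (use assms in \<open>auto simp: outer_rank_def v split: if_splits\<close>)
  show "R_inner (Suc d) (Suc i) (Suc e) (R_outer (Suc (d + e)) (Suc (l + e)) (Suc p) y) =
      R_inner (Suc (d + p)) (Suc i) (Suc e) y"
    unfolding R_inner_def delete_leaves_R_outer[OF le(1) y(1)]
    by (rule delete_leaves_cong) (use assms in \<open>auto simp: outer_rank_def v split: if_splits\<close>)
  show "R_inner (Suc (d + e)) (Suc (l + e)) (Suc p) y =
      R_inner (Suc d) (Suc l) (Suc p) (R_outer (Suc (d + p)) (Suc i) (Suc e) y)"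
    unfolding R_inner_def delete_leaves_R_outer[OF le(2) y(2)]
    by (rule delete_leaves_cong) (use assms in \<open>auto simp: outer_rank_def v split: if_splits\<close>)
qed

section \<open>The operad of cochains\<close>

lemma vector_space_scale_cochain: "vector_space s \<Longrightarrow> vector_space (scale_cochain s)"
  by (simp add: vector_space_def scale_cochain_def fun_eq_iff)

lemma split_list_at:
  assumes "n \<le> length xs"
  obtains ys zs where "xs = ys @ zs" "length ys = n"
  using that[of "take n xs" "drop n xs"] assms by simp

text \<open>Splitting the list around the varied entry, in place of an indexed update, matches the
  shape in which \<open>circ\<close> assembles its arguments.\<close>

lemma CY_iff:
  "f \<in> CY s s' n \<longleftrightarrow>
     (\<forall>y xs. \<not> (y \<in> Y n \<and> length xs = n) \<longrightarrow> f y xs = 0) \<and>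
     (\<forall>y us vs. y \<in> Y n \<longrightarrow> Suc (length us + length vs) = n \<longrightarrow>
        Vector_Spaces.linear s s' (\<lambda>x. f y (us @ x # vs)))" (is "_ \<longleftrightarrow> ?Z \<and> ?R")
proof -
  have "(\<forall>y\<in>Y n. \<forall>xs. length xs = n \<longrightarrow>
            (\<forall>i<n. Vector_Spaces.linear s s' (\<lambda>x. f y (xs[i := x])))) \<longleftrightarrow> ?R" (is "?L \<longleftrightarrow> _")
  proof
    show "?R" if L: "?L"
    proof (intro allI impI)
      fix y and us vs :: "'a list"
      assume *: "y \<in> Y n" "Suc (length us + length vs) = n"
      then have "Vector_Spaces.linear s s' (\<lambda>x. f y ((us @ 0 # vs)[length us := x]))"
        using L[rule_format, of y "us @ 0 # vs" "length us"] by simp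
      then show "Vector_Spaces.linear s s' (\<lambda>x. f y (us @ x # vs))"
        by simp
    qed
    show ?L if R: ?R
      using R by (auto simp: upd_conv_take_nth_drop)
  qed
  then show ?thesis unfolding CY_def by simp
qed

lemma CY_zero: "f \<in> CY s s' n \<Longrightarrow> \<not> (y \<in> Y n \<and> length xs = n) \<Longrightarrow> f y xs = 0"
  by (simp add: CY_iff)

lemma CY_linear:
  "f \<in> CY s s' n \<Longrightarrow> y \<in> Y n \<Longrightarrow> Suc (length us + length vs) = n \<Longrightarrow>
     Vector_Spaces.linear s s' (\<lambda>x. f y (us @ x # vs))"
  by (simp add: CY_iff)

lemma linear_hom_props:
  assumes "Vector_Spaces.linear s s' h"
  shows "h (x + y) = h x + h y" "h (s c x) = s' c (h x)" "h 0 = 0" "h (- x) = - h x"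
    "h (x - y) = h x - h y"
proof -
  interpret Vector_Spaces.linear s s' h by fact
  show "h (x + y) = h x + h y" "h (s c x) = s' c (h x)" "h 0 = 0" "h (- x) = - h x"
    "h (x - y) = h x - h y"
    by (simp_all add: add scale neg diff)
qed

text \<open>Off the domain of \<open>f\<close> all terms are 0, so multilinearity can be used for
  every tree and list without tracking lengths.\<close>

lemma CY_slot:
  assumes "f \<in> CY s s' n"
  shows "f y (us @ (x + x') # vs) = f y (us @ x # vs) + f y (us @ x' # vs)"
    and "f y (us @ (x - x') # vs) = f y (us @ x # vs) - f y (us @ x' # vs)"
    and "vector_space s' \<Longrightarrow> f y (us @ s c x # vs) = s' c (f y (us @ x # vs))"
    and "f y (us @ 0 # vs) = 0"
proof -
  have "f y (us @ (x + x') # vs) = f y (us @ x # vs) + f y (us @ x' # vs) \<and>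
    f y (us @ (x - x') # vs) = f y (us @ x # vs) - f y (us @ x' # vs) \<and>
    (vector_space s' \<longrightarrow> f y (us @ s c x # vs) = s' c (f y (us @ x # vs))) \<and>
    f y (us @ 0 # vs) = 0"
  proof (cases "y \<in> Y n \<and> Suc (length us + length vs) = n")
    case True
    then show ?thesis
      using linear_hom_props[OF CY_linear[OF assms, of y us vs]] by simp
  next
    case False
    then have "f y (us @ z # vs) = 0" for z
      by (intro CY_zero[OF assms]) auto
    moreover have "s' c 0 = 0" if "vector_space s'"
    proof -
      interpret vector_space s' by fact
      show ?thesis by simp
    qed
    ultimately show ?thesis by simp
  qed
  then show "f y (us @ (x + x') # vs) = f y (us @ x # vs) + f y (us @ x' # vs)"
    and "f y (us @ (x - x') # vs) = f y (us @ x # vs) - f y (us @ x' # vs)"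
    and "vector_space s' \<Longrightarrow> f y (us @ s c x # vs) = s' c (f y (us @ x # vs))"
    and "f y (us @ 0 # vs) = 0" by blast+
qed

lemma subspace_CY:
  assumes "vector_space s" "vector_space s'"
  shows "module.subspace (scale_cochain s') (CY s s' n)"
proof -
  interpret F: vector_space "scale_cochain s'"
    by (rule vector_space_scale_cochain) fact
  interpret vector_space_pair s s'
    using assms by (simp add: vector_space_pair_def)
  show ?thesis
    by (auto simp: F.subspace_def CY_iff scale_cochain_def linear_zero linear_compose_add
        linear_compose_scale_right vs2.scale_zero_right)
qed

lemma circ_append:
  assumes "i \<le> d" "y \<in> Y (Suc (d + e))" "length us = i" "length vs = Suc e" "length ws = d - i"
  shows "circ (Suc d) (Suc e) (Suc i) f g y (us @ vs @ ws) =
    f (R_outer (Suc d) (Suc i) (Suc e) y) (us @ g (R_inner (Suc d) (Suc i) (Suc e) y) vs # ws)"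
  using assms by (simp add: circ_def)

lemma circ_outside:
  "\<not> (y \<in> Y (Suc (d + e)) \<and> length xs = Suc (d + e)) \<Longrightarrow>
     circ (Suc d) (Suc e) (Suc i) f g y xs = 0"
  by (auto simp: circ_def)

text \<open>The varied entry lies before, inside or behind the block that is passed to
  \<open>g\<close>. In the middle case two linear maps are composed.\<close>

lemma circ_CY:
  assumes i: "i \<le> d" and f: "f \<in> CY s s (Suc d)" and g: "g \<in> CY s s (Suc e)"
  shows "circ (Suc d) (Suc e) (Suc i) f g \<in> CY s s (Suc (d + e))"
  unfolding CY_iff
proof (intro conjI allI impI)
  fix y and us vs :: "'a list"
  let ?c = "circ (Suc d) (Suc e) (Suc i) f g"
  let ?o = "R_outer (Suc d) (Suc i) (Suc e) y" and ?i = "R_inner (Suc d) (Suc i) (Suc e) y"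
  assume y: "y \<in> Y (Suc (d + e))" and len: "Suc (length us + length vs) = Suc (d + e)"
  note R = R_outer_in_Y[OF i y] R_inner_in_Y[OF i y]
  note ap = circ_append[OF i y]
  consider "length us < i" | "i \<le> length us" "length us \<le> i + e" | "i + e < length us"
    by linarith
  then show "Vector_Spaces.linear s s (\<lambda>x. ?c y (us @ x # vs))"
  proof cases
    case 1
    obtain v1 v2 where v: "vs = v1 @ v2" "length v1 = i - length us - 1"
      by (rule split_list_at[of "i - length us - 1" vs]) (use 1 i len in auto)
    obtain v3 v4 where v': "v2 = v3 @ v4" "length v3 = Suc e"
      by (rule split_list_at[of "Suc e" v2]) (use 1 i len v in auto)
    have "?c y (us @ x # vs) = f ?o (us @ x # (v1 @ g ?i v3 # v4))" for x
      using ap[of "us @ x # v1" v3 v4 f g] 1 v v' len i by simp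
    then show ?thesis
      using CY_linear[OF f R(1), of us "v1 @ g ?i v3 # v4"] 1 v v' len i by simp
  next
    case 2
    then obtain u1 u2 where u: "us = u1 @ u2" "length u1 = i"
      using split_list_at[of i us] by auto
    obtain v1 v2 where v: "vs = v1 @ v2" "length v1 = e - length u2"
      by (rule split_list_at[of "e - length u2" vs]) (use 2 u i len in auto)
    have "?c y (us @ x # vs) = ((\<lambda>z. f ?o (u1 @ z # v2)) \<circ> (\<lambda>x. g ?i (u2 @ x # v1))) x" for x
      using ap[of u1 "u2 @ x # v1" v2 f g] 2 u v len i by simp
    moreover have "Vector_Spaces.linear s s ((\<lambda>z. f ?o (u1 @ z # v2)) \<circ> (\<lambda>x. g ?i (u2 @ x # v1)))"
      using CY_linear[OF f R(1), of u1 v2] CY_linear[OF g R(2), of u2 v1] 2 u v len i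
      by (intro Vector_Spaces.linear_compose[of s s _ s]) simp_all
    ultimately show ?thesis by presburger
  next
    case 3
    then obtain u1 u2 where u: "us = u1 @ u2" "length u1 = i"
      using split_list_at[of i us] by auto
    with 3 obtain u3 u4 where u': "u2 = u3 @ u4" "length u3 = Suc e"
      using split_list_at[of "Suc e" u2] by auto
    have "?c y (us @ x # vs) = f ?o ((u1 @ g ?i u3 # u4) @ x # vs)" for x
      using ap[of u1 u3 "u4 @ x # vs" f g] 3 u u' len i by simp
    then show ?thesis
      using CY_linear[OF f R(1), of "u1 @ g ?i u3 # u4" vs] 3 u u' len i by simp
  qed
qed (rule circ_outside)

lemma circ_eqI:
  assumes i: "i \<le> d" and F: "\<And>y xs. \<not> (y \<in> Y (Suc (d + e)) \<and> length xs = Suc (d + e)) \<Longrightarrow> F y xs = 0"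
    and eq: "\<And>y us vs ws. \<lbrakk>y \<in> Y (Suc (d + e)); length us = i; length vs = Suc e; length ws = d - i\<rbrakk> \<Longrightarrow>
       F y (us @ vs @ ws) =
       f (R_outer (Suc d) (Suc i) (Suc e) y) (us @ g (R_inner (Suc d) (Suc i) (Suc e) y) vs # ws)"
  shows "circ (Suc d) (Suc e) (Suc i) f g = F"
proof (intro ext)
  fix y xs
  show "circ (Suc d) (Suc e) (Suc i) f g y xs = F y xs"
  proof (cases "y \<in> Y (Suc (d + e)) \<and> length xs = Suc (d + e)")
    case True
    then obtain us zs where xs: "xs = us @ zs" "length us = i"
      using split_list_at[of i xs] i by auto
    then obtain vs ws where zs: "zs = vs @ ws" "length vs = Suc e"
      using split_list_at[of "Suc e" zs] i True by auto
    show ?thesis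
      unfolding xs zs using True xs zs i by (subst circ_append) (auto simp: eq)
  qed (simp add: F circ_outside)
qed

text \<open>Cutting the list at the blocks of both insertions leaves only the tree arguments to
  compare.\<close>

lemma circ_sequential:
  assumes i: "i \<le> d" and j: "j \<le> e"
  shows "circ (Suc (d + e)) (Suc p) (Suc (i + j)) (circ (Suc d) (Suc e) (Suc i) f g) h =
    circ (Suc d) (Suc (e + p)) (Suc i) f (circ (Suc e) (Suc p) (Suc j) g h)"
proof (rule sym, rule circ_eqI[OF i])
  fix y and us vs ws :: "'a list"
  assume y: "y \<in> Y (Suc (d + (e + p)))"
    and len: "length us = i" "length vs = Suc (e + p)" "length ws = d - i"
  obtain v1 z where z: "vs = v1 @ z" "length v1 = j"
    using split_list_at[of j vs] j len by auto
  then obtain v2 v3 where v: "z = v2 @ v3" "length v2 = Suc p"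
    using split_list_at[of "Suc p" z] j len by auto
  have y': "y \<in> Y (Suc (d + e + p))"
    using y by (simp add: add.assoc)
  have ij: "i + j \<le> d + e"
    using i j by simp
  note eqs = R_sequential[OF i j y']
  have "circ (Suc (d + e)) (Suc p) (Suc (i + j)) (circ (Suc d) (Suc e) (Suc i) f g) h y
      ((us @ v1) @ v2 @ (v3 @ ws)) =
    circ (Suc d) (Suc e) (Suc i) f g (R_outer (Suc (d + e)) (Suc (i + j)) (Suc p) y)
      (us @ (v1 @ h (R_inner (Suc (d + e)) (Suc (i + j)) (Suc p) y) v2 # v3) @ ws)"
    using len z v i j y' by (subst circ_append) auto
  also have "\<dots> = f (R_outer (Suc d) (Suc i) (Suc (e + p)) y)
    (us @ g (R_outer (Suc e) (Suc j) (Suc p) (R_inner (Suc d) (Suc i) (Suc (e + p)) y))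
       (v1 @ h (R_inner (Suc e) (Suc j) (Suc p) (R_inner (Suc d) (Suc i) (Suc (e + p)) y)) v2 # v3)
      # ws)"
    using len z v i j R_outer_in_Y[OF ij y'] by (subst circ_append) (auto simp: eqs)
  also have "g (R_outer (Suc e) (Suc j) (Suc p) (R_inner (Suc d) (Suc i) (Suc (e + p)) y))
       (v1 @ h (R_inner (Suc e) (Suc j) (Suc p) (R_inner (Suc d) (Suc i) (Suc (e + p)) y)) v2 # v3) =
     circ (Suc e) (Suc p) (Suc j) g h (R_inner (Suc d) (Suc i) (Suc (e + p)) y) vs"
    unfolding z v using len z v j R_inner_in_Y[OF i y] by (subst circ_append) auto
  finally show "circ (Suc (d + e)) (Suc p) (Suc (i + j)) (circ (Suc d) (Suc e) (Suc i) f g) h y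
      (us @ vs @ ws) = f (R_outer (Suc d) (Suc i) (Suc (e + p)) y)
      (us @ circ (Suc e) (Suc p) (Suc j) g h (R_inner (Suc d) (Suc i) (Suc (e + p)) y) vs # ws)"
    by (simp add: z v)
qed (rule circ_outside, simp add: add.assoc)

lemma circ_parallel:
  assumes i: "i < l" and l: "l \<le> d"
  shows "circ (Suc (d + e)) (Suc p) (Suc (l + e)) (circ (Suc d) (Suc e) (Suc i) f g) h =
    circ (Suc (d + p)) (Suc e) (Suc i) (circ (Suc d) (Suc p) (Suc l) f h) g"
proof (rule circ_eqI)
  show le: "l + e \<le> d + e"
    using l by simp
  fix y and us vs ws :: "'a list"
  assume y: "y \<in> Y (Suc (d + e + p))"
    and len: "length us = l + e" "length vs = Suc p" "length ws = d + e - (l + e)"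
  have le': "i \<le> d + p" "i \<le> d"
    using i l by simp_all
  have y': "y \<in> Y (Suc (d + p + e))"
    using y by (simp add: ac_simps)
  obtain u1 z where z: "us = u1 @ z" "length u1 = i"
    using split_list_at[of i us] i len by auto
  then obtain u2 u3 where u: "z = u2 @ u3" "length u2 = Suc e"
    using split_list_at[of "Suc e" z] i len by auto
  note eqs = R_parallel[OF i l y]
  let ?h = "h (R_inner (Suc (d + e)) (Suc (l + e)) (Suc p) y) vs"
  have "circ (Suc (d + p)) (Suc e) (Suc i) (circ (Suc d) (Suc p) (Suc l) f h) g y
      (u1 @ u2 @ (u3 @ vs @ ws)) =
    circ (Suc d) (Suc p) (Suc l) f h (R_outer (Suc (d + p)) (Suc i) (Suc e) y)
      ((u1 @ g (R_inner (Suc (d + p)) (Suc i) (Suc e) y) u2 # u3) @ vs @ ws)"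
    using len z u i l y' by (subst circ_append) auto
  also have "\<dots> = f (R_outer (Suc d) (Suc i) (Suc e) (R_outer (Suc (d + e)) (Suc (l + e)) (Suc p) y))
      (u1 @ g (R_inner (Suc (d + p)) (Suc i) (Suc e) y) u2 # u3 @ ?h # ws)"
    using len z u i l R_outer_in_Y[OF le'(1) y'] by (subst circ_append) (auto simp: eqs)
  also have "\<dots> = circ (Suc d) (Suc e) (Suc i) f g (R_outer (Suc (d + e)) (Suc (l + e)) (Suc p) y)
      (u1 @ u2 @ (u3 @ ?h # ws))"
    using len z u i l R_outer_in_Y[OF le y] by (subst circ_append) (auto simp: eqs)
  finally show "circ (Suc (d + p)) (Suc e) (Suc i) (circ (Suc d) (Suc p) (Suc l) f h) g y
      (us @ vs @ ws) = circ (Suc d) (Suc e) (Suc i) f g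
      (R_outer (Suc (d + e)) (Suc (l + e)) (Suc p) y) (us @ ?h # ws)"
    by (simp add: z u)
qed (rule circ_outside, simp add: ac_simps)

lemma ns_operad_CY:
  assumes "vector_space (s :: 'k :: field_char_0 \<Rightarrow> 'd :: ab_group_add \<Rightarrow> 'd)"
  shows "ns_operad (scale_cochain s) (\<lambda>d. CY s s (Suc d)) (\<lambda>d e i. circ (Suc d) (Suc e) (Suc i))"
proof -
  interpret D: vector_space s by fact
  interpret F: vector_space "scale_cochain s"
    by (rule vector_space_scale_cochain) fact
  show ?thesis
  proof unfold_locales
    fix d e i and f g g' :: "('d, 'd) cochain" and c :: 'k
    assume i: "i \<le> d" and f: "f \<in> CY s s (Suc d)"
    note [simp] = CY_slot[OF f] D.vector_space_axioms
    show "circ (Suc d) (Suc e) (Suc i) f (g + g') =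
        circ (Suc d) (Suc e) (Suc i) f g + circ (Suc d) (Suc e) (Suc i) f g'"
      by (auto simp: circ_def fun_eq_iff)
    show "circ (Suc d) (Suc e) (Suc i) f (scale_cochain s c g) =
        scale_cochain s c (circ (Suc d) (Suc e) (Suc i) f g)"
      by (auto simp: circ_def fun_eq_iff scale_cochain_def)
  next
    fix d e i and f f' g :: "('d, 'd) cochain" and c :: 'k
    show "circ (Suc d) (Suc e) (Suc i) (f + f') g =
        circ (Suc d) (Suc e) (Suc i) f g + circ (Suc d) (Suc e) (Suc i) f' g"
      by (auto simp: circ_def fun_eq_iff)
    show "circ (Suc d) (Suc e) (Suc i) (scale_cochain s c f) g =
        scale_cochain s c (circ (Suc d) (Suc e) (Suc i) f g)"
      by (auto simp: circ_def fun_eq_iff scale_cochain_def)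
  qed (simp_all only: subspace_CY[OF assms assms] circ_CY circ_sequential circ_parallel)
qed

text \<open>Counting inputs from 0 and shifting arities turns the exponents
  \<open>(i - 1) * (n - 1)\<close> into \<open>i * e\<close>, so the two brackets agree term by
  term.\<close>

lemma MM_bracket_eq_lb:
  fixes f g :: "('d :: ab_group_add, 'd) cochain"
  assumes "ns_operad scale (C :: nat \<Rightarrow> ('d, 'd) cochain set) (\<lambda>d e i. circ (Suc d) (Suc e) (Suc i))"
  shows "MM_bracket (Suc d) (Suc e) f g =
    ns_operad.lb (\<lambda>d e i. circ (Suc d) (Suc e) (Suc i)) d e f g"
proof -
  interpret ns_operad scale C "\<lambda>d e i. circ (Suc d) (Suc e) (Suc i)" by fact
  show ?thesis
    unfolding MM_bracket_def lb_def pl_def One_nat_def sum.atLeast1_atMost_eq lessThan_Suc_atMost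
    by simp
qed

section \<open>The derived bracket on the split extension\<close>

lemma extend_zero_inject: "extend_zero f = extend_zero g \<longleftrightarrow> f = g"
proof
  assume eq: "extend_zero f = extend_zero g"
  show "f = g"
  proof (intro ext)
    fix y xs
    show "f y xs = g y xs"
      \<comment> \<open>Any components in A would do, since an extension by zero ignores
        them.\<close>
      using fun_cong[OF fun_cong[OF eq, of y], of "map (Pair undefined) xs"]
      by (simp add: extend_zero_def o_def)
  qed
qed simp

lemma extend_zero_add:
  fixes f g :: "('m :: ab_group_add, 'a :: ab_group_add) cochain"
  shows "extend_zero (f + g) = extend_zero f + extend_zero g"
  by (simp add: extend_zero_def fun_eq_iff)

lemma extend_zero_minus:
  fixes f :: "('m :: ab_group_add, 'a :: ab_group_add) cochain"
  shows "extend_zero (- f) = - extend_zero f"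
  by (simp add: extend_zero_def fun_eq_iff)

lemma extend_zero_zero [simp]: "extend_zero 0 = 0"
  by (simp add: extend_zero_def fun_eq_iff zero_prod_def)

lemma extend_zero_signed:
  fixes f :: "('m :: ab_group_add, 'a :: ab_group_add) cochain"
  shows "extend_zero (signed k f) = signed k (extend_zero f)"
  by (simp add: signed_def extend_zero_minus)

text \<open>Each entry has its own factor, so that below the entries from M can be doubled while
  those from A are kept.\<close>

lemma CY_scale_all:
  assumes "f \<in> CY s s' n" "vector_space s'" "length cs = length xs"
  shows "f y (us @ map2 s cs xs) = s' (prod_list cs) (f y (us @ xs))"
proof -
  interpret vector_space s' by fact
  show ?thesis
    using assms(3)
  proof (induction cs xs arbitrary: us rule: list_induct2)
    case (Cons c cs x xs)
    have "f y (us @ map2 s (c # cs) (x # xs)) = s' c (f y ((us @ [x]) @ map2 s cs xs))"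
      using CY_slot(3)[OF assms(1,2)] by simp
    then show ?case
      unfolding Cons.IH by simp
  qed simp
qed

section \<open>Trees with at most three vertices\<close>

lemma Y_0: "y \<in> Y 0 \<longleftrightarrow> y = Leaf"
  by (cases y) (auto simp: Y_def)

lemma Leaf_in_Y [simp]: "Leaf \<notin> Y (Suc n)"
  by (simp add: Y_def)

lemma Graft_in_Y_Suc: "Graft l r \<in> Y (Suc n) \<longleftrightarrow> (\<exists>k\<le>n. l \<in> Y k \<and> r \<in> Y (n - k))"
proof
  assume "Graft l r \<in> Y (Suc n)"
  then show "\<exists>k\<le>n. l \<in> Y k \<and> r \<in> Y (n - k)"
    by (intro exI[of _ "vertices l"]) (auto simp: Y_def)
qed (auto simp: Y_def)

lemma ex_le_Suc: "(\<exists>k\<le>Suc n. Q k) \<longleftrightarrow> (\<exists>k\<le>n. Q k) \<or> Q (Suc n)"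
  by (auto simp: le_Suc_eq)

lemma Y_1: "y \<in> Y (Suc 0) \<longleftrightarrow> y = y_one"
  by (cases y) (simp_all add: Graft_in_Y_Suc Y_0 y_one_def)

lemma Y_2: "y \<in> Y (Suc (Suc 0)) \<longleftrightarrow> y = y_dashv \<or> y = y_vdash"
  by (cases y)
    (simp_all add: Graft_in_Y_Suc ex_le_Suc Y_0 Y_1 y_one_def y_dashv_def y_vdash_def)

lemma Y_3: "y \<in> Y (Suc (Suc (Suc 0))) \<longleftrightarrow>
    y = Graft Leaf y_dashv \<or> y = Graft Leaf y_vdash \<or> y = Graft y_one y_one \<or>
    y = Graft y_dashv Leaf \<or> y = Graft y_vdash Leaf"
  by (cases y) (simp_all add: Graft_in_Y_Suc ex_le_Suc Y_0 Y_1 Y_2 conj_disj_distribL conj_disj_distribR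
      disj_assoc)

lemma delete_leaves_empty [simp]: "delete_leaves {} y = y"
proof -
  have "prune {} k y = Some y" for k
    by (induction y arbitrary: k) simp_all
  then show ?thesis by (simp add: delete_leaves_def)
qed

text \<open>In characteristic 0 distinct powers of 2 are distinct scalars, so a nonzero vector
  cannot have two weights.\<close>

lemma power2_scale_cancel:
  assumes "vector_space (s :: 'k :: field_char_0 \<Rightarrow> 'v :: ab_group_add \<Rightarrow> 'v)"
    and "s (2 ^ w) v = s (2 ^ n) v" "w < n"
  shows "v = 0"
proof -
  interpret vector_space s by fact
  have "(2 :: 'k) ^ w \<noteq> 2 ^ n"
  proof
    assume "(2 :: 'k) ^ w = 2 ^ n"
    then have "of_nat (2 ^ w) = (of_nat (2 ^ n) :: 'k)"
      by simp
    then show False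
      using assms(3) by (simp only: of_nat_eq_iff) simp
  qed
  then show ?thesis
    using assms(2) by auto
qed

section \<open>The product \<Delta> on A \<oplus> M and the grading by M-degree\<close>

context alg_bimodule
begin

lemmas action_simps =
  linear_hom_props[OF mul_linear_left] linear_hom_props[OF mul_linear_right]
  linear_hom_props[OF lact_linear_left] linear_hom_props[OF lact_linear_right]
  linear_hom_props[OF ract_linear_left] linear_hom_props[OF ract_linear_right]

definition sD :: "'k \<Rightarrow> 'a \<times> 'm \<Rightarrow> 'a \<times> 'm" where
  "sD c x = (scaleA c (fst x), scaleM c (snd x))"

sublocale D: vector_space sD
  by unfold_locales
    (auto simp: sD_def scale_right_distrib M.scale_right_distrib scale_left_distrib
      M.scale_left_distrib)

sublocale G: ns_operad "scale_cochain sD" "\<lambda>d. CY sD sD (Suc d)"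
  "\<lambda>d e i. circ (Suc d) (Suc e) (Suc i)"
  by (rule ns_operad_CY) (rule D.vector_space_axioms)

lemma MM_bracket_lb: "MM_bracket (Suc d) (Suc e) f g = G.lb d e f g"
  by (rule MM_bracket_eq_lb) (rule G.ns_operad_axioms)

lemma linear_sD_iff:
  "Vector_Spaces.linear sD sD h \<longleftrightarrow>
     (\<forall>x y. h (x + y) = h x + h y) \<and> (\<forall>c x. h (sD c x) = sD c (h x))"
  by (simp add: Vector_Spaces.linear_iff D.vector_space_axioms)

abbreviation "dl \<equiv> Delta mul lact ract"

abbreviation "L n \<equiv> CY scaleM scaleA n"

lemma dl_eval [simp]:
  "dl y [x, x'] = (if y = y_dashv then (mul (fst x) (fst x'), ract (snd x) (fst x'))
     else if y = y_vdash then (mul (fst x) (fst x'), lact (fst x) (snd x')) else 0)"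
  by (cases x; cases x') (simp add: Delta_def)

lemma dl_CY: "dl \<in> CY sD sD (Suc (Suc 0))"
  unfolding CY_iff
proof (intro conjI allI impI)
  fix y and xs :: "('a \<times> 'm) list"
  assume "\<not> (y \<in> Y (Suc (Suc 0)) \<and> length xs = Suc (Suc 0))"
  then show "dl y xs = 0"
    by (auto simp: Delta_def Y_2 split: list.splits)
next
  fix y and us vs :: "('a \<times> 'm) list"
  assume "Suc (length us + length vs) = Suc (Suc 0)"
  then consider z where "us = []" "vs = [z]" | z where "us = [z]" "vs = []"
    by (auto simp: length_Suc_conv add_is_1)
  then show "Vector_Spaces.linear sD sD (\<lambda>x. dl y (us @ x # vs))"
    by cases (auto simp: linear_sD_iff action_simps sD_def zero_prod_def)
qed

lemma extend_zero_CY: "f \<in> L n \<Longrightarrow> extend_zero f \<in> CY sD sD n"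
  unfolding CY_iff[of "extend_zero f"] linear_sD_iff
  by (auto simp: extend_zero_def CY_zero CY_slot sD_def vector_space_axioms zero_prod_def)

lemma extend_zero_scale:
  "extend_zero (scale_cochain scaleA c f) = scale_cochain sD c (extend_zero f)"
  by (simp add: extend_zero_def scale_cochain_def sD_def)

text \<open>
  Cochains \<open>f : D\<^sup>\<otimes>\<^sup>n \<rightarrow> D\<close> lowering the \<open>M\<close>-degree by \<open>k\<close>, expressed through the
  automorphism that multiplies \<open>M\<close> by 2. Since an output has \<open>M\<close>-degree at least \<open>0\<close>,
  those of arity \<open>k\<close> take all inputs in \<open>M\<close> and the output in \<open>A\<close>.
\<close>

definition stretch :: "'a \<times> 'm \<Rightarrow> 'a \<times> 'm" where
  "stretch x = (fst x, scaleM 2 (snd x))"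

definition lowers :: "nat \<Rightarrow> ('a \<times> 'm, 'a \<times> 'm) cochain \<Rightarrow> bool" where
  "lowers k F \<longleftrightarrow> (\<forall>y xs. F y (map stretch xs) = sD (2 ^ k) (stretch (F y xs)))"

lemma stretch_simps:
  "stretch (x + y) = stretch x + stretch y" "stretch (x - y) = stretch x - stretch y"
  "stretch (- x) = - stretch x" "stretch 0 = 0" "stretch (sD c x) = sD c (stretch x)"
  by (auto simp: stretch_def sD_def M.scale_right_distrib M.scale_right_diff_distrib
      mult.commute zero_prod_def)

lemma lowers_add: "lowers k F \<Longrightarrow> lowers k F' \<Longrightarrow> lowers k (F + F')"
  by (simp add: lowers_def stretch_simps D.scale_right_distrib)

lemma lowers_diff: "lowers k F \<Longrightarrow> lowers k F' \<Longrightarrow> lowers k (F - F')"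
  by (simp add: lowers_def stretch_simps D.scale_right_diff_distrib)

lemma lowers_zero: "lowers k 0"
  by (simp add: lowers_def stretch_simps)

lemma lowers_signed: "lowers k F \<Longrightarrow> lowers k (signed j F)"
  by (simp add: signed_def lowers_def stretch_simps)

lemma lowers_sum: "(\<And>i. i \<in> I \<Longrightarrow> lowers k (F i)) \<Longrightarrow> lowers k (\<Sum>i\<in>I. F i)"
  by (induction I rule: infinite_finite_induct) (simp_all add: lowers_zero lowers_add)

text \<open>Degree shifts add up: the factor \<open>2 ^ l\<close> contributed by \<open>G\<close>
  leaves the slot of \<open>F\<close> by linearity.\<close>

lemma lowers_circ:
  assumes F: "F \<in> CY sD sD (Suc d)" and "lowers k F" "lowers l G"
  shows "lowers (k + l) (circ (Suc d) (Suc e) (Suc i) F G)"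
  unfolding lowers_def
proof (intro allI)
  fix y and xs :: "('a \<times> 'm) list"
  let ?c = "circ (Suc d) (Suc e) (Suc i) F G y"
  let ?o = "R_outer (Suc d) (Suc i) (Suc e) y" and ?i = "R_inner (Suc d) (Suc i) (Suc e) y"
  let ?us = "take i xs" and ?vs = "take (Suc e) (drop i xs)" and ?ws = "drop (Suc (i + e)) xs"
  show "?c (map stretch xs) = sD (2 ^ (k + l)) (stretch (?c xs))"
  proof (cases "y \<in> Y (Suc (d + e)) \<and> length xs = Suc (d + e)")
    case True
    then have c: "?c xs = F ?o (?us @ G ?i ?vs # ?ws)"
      and "?c (map stretch xs) =
        F ?o (map stretch ?us @ G ?i (map stretch ?vs) # map stretch ?ws)"
      by (simp_all add: circ_def take_map drop_map)
    note this(2)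
    also have "G ?i (map stretch ?vs) = sD (2 ^ l) (stretch (G ?i ?vs))"
      using assms(3) unfolding lowers_def by blast
    also have "F ?o (map stretch ?us @ sD (2 ^ l) (stretch (G ?i ?vs)) # map stretch ?ws) =
        sD (2 ^ l) (F ?o (map stretch (?us @ G ?i ?vs # ?ws)))"
      by (simp add: CY_slot(3)[OF F D.vector_space_axioms])
    also have "F ?o (map stretch (?us @ G ?i ?vs # ?ws)) = sD (2 ^ k) (stretch (?c xs))"
      unfolding c using assms(2) unfolding lowers_def by blast
    finally show ?thesis
      by (simp add: power_add mult.commute)
  next
    case False
    then show ?thesis
      by (simp add: circ_outside stretch_simps)
  qed
qed

lemma lowers_lb:
  assumes "F \<in> CY sD sD (Suc d)" "G \<in> CY sD sD (Suc e)" "lowers k F" "lowers l G"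
  shows "lowers (k + l) (G.lb d e F G)"
  unfolding G.lb_def G.pl_def
  using lowers_circ[OF assms(1,3,4)] lowers_circ[OF assms(2,4,3)]
  by (intro lowers_diff lowers_signed lowers_sum) (simp_all add: add.commute)

text \<open>\<Delta> preserves the M-degree: it sends A times A to A, mixed products to M, and M
  times M to 0.\<close>

lemma lowers_dl: "lowers 0 dl"
  unfolding lowers_def
proof (intro allI)
  fix y and xs :: "('a \<times> 'm) list"
  show "dl y (map stretch xs) = sD (2 ^ 0) (stretch (dl y xs))"
  proof (cases "length xs = Suc (Suc 0)")
    case True
    then obtain x x' where "xs = [x, x']"
      by (auto simp: length_Suc_conv)
    then show ?thesis
      by (simp add: stretch_def action_simps zero_prod_def)
  next
    case False
    then show ?thesis
      using CY_zero[OF dl_CY] by (simp add: stretch_simps)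
  qed
qed

text \<open>The value depends only on the \<open>n\<close> components in M, each of which is
  doubled, and it lies in A, which \<open>stretch\<close> fixes.\<close>

lemma lowers_extend_zero:
  assumes f: "f \<in> L n"
  shows "lowers n (extend_zero f)"
  unfolding lowers_def
proof (intro allI)
  fix y and xs :: "('a \<times> 'm) list"
  have "map snd (map stretch xs) = map2 scaleM (replicate (length xs) 2) (map snd xs)"
    by (simp add: stretch_def map2_map_map zip_replicate1)
  then have "f y (map snd (map stretch xs)) = scaleA (2 ^ length xs) (f y (map snd xs))"
    using CY_scale_all[OF f vector_space_axioms, of "replicate (length xs) 2" "map snd xs" y "[]"]
    by (simp add: prod_list_replicate)
  moreover have "f y (map snd xs) = 0" if "length xs \<noteq> n"
    using CY_zero[OF f] that by simp
  ultimately show "extend_zero f y (map stretch xs) = sD (2 ^ n) (stretch (extend_zero f y xs))"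
    by (cases "length xs = n") (simp_all add: extend_zero_def stretch_def sD_def)
qed

text \<open>Expand every entry into its A-part and its M-part. With \<open>m\<close> entries in M,
  the value is multiplied by \<open>2 ^ m\<close>, but \<open>lowers\<close> demands
  \<open>2 ^ n\<close> on its A-component and \<open>2 ^ Suc n\<close> on its M-component. As
  \<open>m \<le> n\<close>, only the A-component for \<open>m = n\<close> can be nonzero.\<close>

lemma lowers_arity_imp_extend_zero:
  assumes F: "F \<in> CY sD sD n" and w: "lowers n F"
  obtains h where "h \<in> L n" "extend_zero h = F"
proof -
  define pure where "pure x \<longleftrightarrow> fst x = 0 \<or> snd x = 0" for x :: "'a \<times> 'm"
  have step1: "snd (F y xs) = 0" "(\<exists>x\<in>set xs. snd x = 0) \<Longrightarrow> F y xs = 0"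
    if xs: "\<forall>x\<in>set xs. pure x" for y xs
  proof -
    \<comment> \<open>On a pure entry \<open>stretch\<close> is multiplication by a scalar: 2 on
      nonzero elements of M, 1 on A.\<close>
    define cs :: "'k list" where "cs = map (\<lambda>x. if snd x = 0 then 1 else 2) xs"
    define m where "m = length (filter (\<lambda>x. snd x \<noteq> 0) xs)"
    have "map2 sD cs xs = map (\<lambda>x. sD (if snd x = 0 then 1 else 2) x) xs"
      unfolding cs_def by (simp add: map2_map_map[where g = id, simplified])
    also have "\<dots> = map stretch xs"
      using xs by (auto simp: pure_def sD_def stretch_def prod_eq_iff)
    finally have "F y (map stretch xs) = sD (prod_list cs) (F y xs)"
      using CY_scale_all[OF F D.vector_space_axioms, of cs xs y "[]"] by (simp add: cs_def)
    moreover have "prod_list cs = 2 ^ m"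
      unfolding cs_def m_def by (induction xs) simp_all
    ultimately have eq: "sD (2 ^ m) (F y xs) = sD (2 ^ n) (stretch (F y xs))"
      using w by (simp add: lowers_def)
    \<comment> \<open>A nonzero value forces the right number of entries, hence
      \<open>m \<le> n\<close>.\<close>
    have n: "length xs = n" if "F y xs \<noteq> 0"
      using CY_zero[OF F] that by blast
    have "m \<le> length xs"
      by (simp add: m_def)
    moreover have "scaleM (2 ^ m) (snd (F y xs)) = scaleM (2 ^ Suc n) (snd (F y xs))"
      using eq by (simp add: sD_def stretch_def mult.commute)
    ultimately show snd0: "snd (F y xs) = 0"
      using power2_scale_cancel[OF M.vector_space_axioms, of m "snd (F y xs)" "Suc n"] n
      by fastforce
    show "F y xs = 0" if "\<exists>x\<in>set xs. snd x = 0"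
    proof (rule ccontr)
      assume nz: "F y xs \<noteq> 0"
      have "m < n"
        unfolding m_def n[OF nz, symmetric] using that by (auto intro: length_filter_less)
      moreover have "scaleA (2 ^ m) (fst (F y xs)) = scaleA (2 ^ n) (fst (F y xs))"
        using eq by (simp add: sD_def stretch_def)
      ultimately have "fst (F y xs) = 0"
        using power2_scale_cancel[OF vector_space_axioms, of m "fst (F y xs)" n] by simp
      with nz snd0 show False
        by (simp add: prod_eq_iff)
    qed
  qed
  have split: "F y (us @ x # vs) = F y (us @ (fst x, 0) # vs) + F y (us @ (0, snd x) # vs)"
    for y us x vs
    using CY_slot(1)[OF F, of y us "(fst x, 0)" "(0, snd x)" vs] by simp
  \<comment> \<open>The induction moves the entries of \<open>vs\<close> one at a time into the pure
    prefix \<open>us\<close>, splitting each of them on the way.\<close>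
  have step2: "F y (us @ vs) = 0"
    if "\<forall>x\<in>set us. pure x" "\<exists>x\<in>set (us @ vs). snd x = 0" for y us vs
    using that
  proof (induction vs arbitrary: us)
    case Nil
    then show ?case using step1(2)[of us y] by simp
  next
    case (Cons x vs)
    have 1: "F y (us @ (fst x, 0) # vs) = 0"
      using Cons.IH[of "us @ [(fst x, 0)]"] Cons.prems by (simp add: pure_def)
    have 2: "F y (us @ (0, snd x) # vs) = 0"
      using Cons.IH[of "us @ [(0, snd x)]"] Cons.prems by (auto simp: pure_def)
    show ?case unfolding split[of y us x vs] 1 2 by simp
  qed
  have step3: "F y (us @ vs) = F y (us @ map (\<lambda>x. (0, snd x)) vs)"
    if "\<forall>x\<in>set us. pure x" for y us vs
    using that
  proof (induction vs arbitrary: us)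
    case (Cons x vs)
    have "F y (us @ (fst x, 0) # vs) = 0"
      using step2[of "us @ [(fst x, 0)]" vs y] Cons.prems by (simp add: pure_def)
    then show ?case
      using Cons.IH[of "us @ [(0, snd x)]"] Cons.prems split[of y us x vs] by (simp add: pure_def)
  qed simp
  \<comment> \<open>Restriction of the inputs to M, followed by projection of the output to
    A.\<close>
  define h where "h = (\<lambda>y us. fst (F y (map (Pair 0) us)))"
  have "h \<in> L n"
  proof -
    have "F y (us @ (0, u + v) # vs) = F y (us @ (0, u) # vs) + F y (us @ (0, v) # vs)"
      "F y (us @ (0, scaleM c u) # vs) = sD c (F y (us @ (0, u) # vs))" for y us vs u v c
      using CY_slot(1)[OF F, of y us "(0, u)" "(0, v)" vs]
        CY_slot(3)[OF F D.vector_space_axioms, of y us c "(0, u)" vs]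
      by (simp_all add: sD_def)
    then show ?thesis
      unfolding CY_iff h_def using CY_zero[OF F]
      by (simp add: Vector_Spaces.linear_iff vector_space_axioms M.vector_space_axioms sD_def)
  qed
  moreover have "extend_zero h = F"
  proof (intro ext)
    fix y xs
    have "F y xs = F y (map (\<lambda>x. (0, snd x)) xs)"
      using step3[of "[]" y xs] by simp
    moreover have "snd (F y (map (\<lambda>x. (0, snd x)) xs)) = 0"
      by (rule step1(1)) (auto simp: pure_def)
    ultimately show "extend_zero h y xs = F y xs"
      by (simp add: extend_zero_def h_def prod_eq_iff o_def)
  qed
  ultimately show ?thesis by (rule that)
qed

section \<open>Brackets with extensions by zero, with \<Delta> and with inner derivations\<close>

lemma lb_extend_zero:
  assumes "f \<in> L (Suc d)" "g \<in> L (Suc e)"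
  shows "G.lb d e (extend_zero f) (extend_zero g) = 0"
proof -
  \<comment> \<open>The inserted value lies in A, so \<open>f\<close> receives 0 in that
    slot.\<close>
  have "circ (Suc d) (Suc e) (Suc i) (extend_zero f) (extend_zero g) = 0"
    if "f \<in> L (Suc d)" for d e i and f g :: "('m, 'a) cochain"
    using CY_slot(4)[OF that] by (auto simp: circ_def extend_zero_def fun_eq_iff zero_prod_def)
  then show ?thesis
    using assms by (simp add: G.lb_def G.pl_def)
qed

text \<open>The bracket of a binary and a unary cochain measures how far \<open>H\<close> is from
  being a derivation of each product \<open>F y\<close>. After deleting leaves, \<open>F\<close>
  always sees \<open>y\<close> and \<open>H\<close> always sees \<open>y_one\<close>.\<close>

lemma lb_1_0_eval:
  assumes "y \<in> Y (Suc (Suc 0))"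
  shows "G.lb (Suc 0) 0 F H y [x, x'] =
    F y [H y_one [x], x'] + F y [x, H y_one [x']] - H y_one [F y [x, x']]"
proof -
  have "G.lb (Suc 0) 0 F H = circ (Suc (Suc 0)) (Suc 0) (Suc 0) F H +
      circ (Suc (Suc 0)) (Suc 0) (Suc (Suc 0)) F H - circ (Suc 0) (Suc (Suc 0)) (Suc 0) H F"
    by (simp add: G.lb_def G.pl_def)
  then show ?thesis
    using assms unfolding Y_2
    by (elim disjE) (simp_all add: circ_def Y_def R_outer_def R_inner_def delete_leaves_def
        y_dashv_def y_vdash_def y_one_def)
qed

lemma CY_2_eqI:
  assumes "F \<in> CY s s' (Suc (Suc 0))" "F' \<in> CY s s' (Suc (Suc 0))"
    and "\<And>y x x'. y \<in> Y (Suc (Suc 0)) \<Longrightarrow> F y [x, x'] = F' y [x, x']"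
  shows "F = F'"
proof (intro ext)
  fix y xs
  show "F y xs = F' y xs"
    using assms CY_zero[OF assms(1), of y xs] CY_zero[OF assms(2), of y xs]
    by (cases "y \<in> Y (Suc (Suc 0)) \<and> length xs = Suc (Suc 0)") (auto simp: length_Suc_conv)
qed

definition ad :: "'a \<Rightarrow> ('a \<times> 'm, 'a \<times> 'm) cochain" where
  "ad a = (\<lambda>y xs. if y \<in> Y (Suc 0) \<and> length xs = Suc 0
     then (mul a (fst (hd xs)) - mul (fst (hd xs)) a, lact a (snd (hd xs)) - ract (snd (hd xs)) a)
     else 0)"

lemma ad_CY: "ad a \<in> CY sD sD (Suc 0)"
  by (auto simp: CY_iff ad_def linear_sD_iff action_simps sD_def scale_right_diff_distrib
      M.scale_right_diff_distrib)

lemma lowers_ad: "lowers 0 (ad a)"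
  by (auto simp: lowers_def ad_def length_Suc_conv stretch_def action_simps
      M.scale_right_diff_distrib zero_prod_def)

lemma ad_add: "ad (a + b) = ad a + ad b"
  by (auto simp: ad_def fun_eq_iff action_simps)

lemma ad_scale: "ad (scaleA c a) = scale_cochain sD c (ad a)"
  by (auto simp: ad_def fun_eq_iff action_simps scale_cochain_def sD_def
      scale_right_diff_distrib M.scale_right_diff_distrib zero_prod_def)

lemma lb_ad_ad: "G.lb 0 0 (ad a) (ad b) = ad (mul a b - mul b a)"
  by (auto simp: G.lb_def G.pl_def circ_def Y_1 R_outer_def R_inner_def delete_leaves_def
      y_one_def ad_def fun_eq_iff length_Suc_conv action_simps mul_assoc lact_mul ract_mul lact_ract
      algebra_simps)

text \<open>By the evaluation formula, this says that the commutator with \<open>a\<close> is a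
  derivation of both products in \<Delta>. It follows from associativity and the bimodule
  laws.\<close>

lemma lb_dl_ad: "G.lb (Suc 0) 0 dl (ad a) = 0"
proof (rule CY_2_eqI)
  show "G.lb (Suc 0) 0 dl (ad a) \<in> CY sD sD (Suc (Suc 0))"
    using G.lb_closed[OF dl_CY ad_CY, of a] by simp
  show "0 \<in> CY sD sD (Suc (Suc 0))"
    using G.subspace_0[OF G.subspace_C[of "Suc 0"]] .
qed (auto simp: lb_1_0_eval Y_2 y_dashv_def y_vdash_def ad_def Y_1 action_simps
      mul_assoc lact_mul ract_mul lact_ract algebra_simps)

text \<open>As \<Delta> has odd degree 1, the bracket is twice the difference of its two partial
  compositions with itself. Their equality on the five trees of \<open>Y 3\<close> amounts to the
  five dialgebra axioms.\<close>

lemma lb_dl_dl: "G.lb (Suc 0) (Suc 0) dl dl = 0"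
proof -
  have "circ (Suc (Suc 0)) (Suc (Suc 0)) (Suc 0) dl dl y xs =
      circ (Suc (Suc 0)) (Suc (Suc 0)) (Suc (Suc 0)) dl dl y xs" for y xs
  proof (cases "y \<in> Y (Suc (Suc (Suc 0))) \<and> length xs = Suc (Suc (Suc 0))")
    case True
    then obtain x1 x2 x3 where "xs = [x1, x2, x3]"
      by (auto simp: length_Suc_conv)
    then show ?thesis
      using conjunct1[OF True] unfolding Y_3
      by (elim disjE) (simp_all add: circ_def R_outer_def R_inner_def delete_leaves_def y_dashv_def
          y_vdash_def y_one_def mul_assoc lact_mul ract_mul lact_ract Y_def)
  qed (auto simp: circ_def)
  then have "circ (Suc (Suc 0)) (Suc (Suc 0)) (Suc 0) dl dl =
      circ (Suc (Suc 0)) (Suc (Suc 0)) (Suc (Suc 0)) dl dl"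
    by (intro ext)
  then show ?thesis
    by (simp add: G.lb_def G.pl_def signed_def)
qed

end

lemma sum_cochain: "(\<Sum>i\<in>I. F i) y xs = (\<Sum>i\<in>I. F i y xs)"
  for F :: "'i \<Rightarrow> ('d, 'e :: ab_group_add) cochain"
  by (induction I rule: infinite_finite_induct) simp_all

context alg_bimodule
begin

text \<open>
  The operator \<open>Theta p f\<close> represents the adjoint action of \<open>f\<close>, and it makes sense also for
  \<open>p = 0\<close>, where \<open>f\<close> itself has no counterpart in the operad.
\<close>

definition Theta :: "nat \<Rightarrow> ('m, 'a) cochain \<Rightarrow> ('a \<times> 'm, 'a \<times> 'm) cochain" where
  "Theta p f = (case p of 0 \<Rightarrow> ad (f Leaf [])
     | Suc d \<Rightarrow> signed p (G.lb (Suc 0) d dl (extend_zero f)))"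

lemma Theta_0: "Theta 0 f = ad (f Leaf [])"
  and Theta_Suc: "Theta (Suc d) f = signed (Suc d) (G.lb (Suc 0) d dl (extend_zero f))"
  by (simp_all add: Theta_def)

lemma lb_dl_CY: "f \<in> L (Suc d) \<Longrightarrow> G.lb (Suc 0) d dl (extend_zero f) \<in> CY sD sD (Suc (Suc d))"
  using G.lb_closed[OF dl_CY extend_zero_CY, of f d] by simp

lemma Theta_CY: "f \<in> L p \<Longrightarrow> Theta p f \<in> CY sD sD (Suc p)"
  by (cases p) (simp_all add: Theta_0 Theta_Suc ad_CY G.subspace_signed G.subspace_C lb_dl_CY)

lemma lowers_Theta: "f \<in> L p \<Longrightarrow> lowers p (Theta p f)"
proof (cases p)
  case (Suc d)
  assume f: "f \<in> L p"
  show ?thesis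
    using lowers_lb[OF dl_CY extend_zero_CY[of f "Suc d"] lowers_dl lowers_extend_zero] f Suc
    by (simp add: Theta_Suc lowers_signed)
qed (simp add: Theta_0 lowers_ad)

lemma Theta_add: "\<lbrakk>f \<in> L p; f' \<in> L p\<rbrakk> \<Longrightarrow> Theta p (f + f') = Theta p f + Theta p f'"
  by (cases p) (simp_all add: Theta_0 Theta_Suc ad_add extend_zero_add signed_add
      G.lb_add_right[OF dl_CY extend_zero_CY extend_zero_CY])

lemma Theta_scale: "f \<in> L p \<Longrightarrow> Theta p (scale_cochain scaleA c f) = scale_cochain sD c (Theta p f)"
proof (cases p)
  case 0
  then show ?thesis by (simp add: Theta_0 flip: ad_scale) (simp add: scale_cochain_def)
next
  case (Suc d)
  assume "f \<in> L p"
  then show ?thesis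
    using G.lb_scale_right[OF dl_CY extend_zero_CY, of f d c] Suc
    by (simp add: Theta_Suc extend_zero_scale G.scale_signed)
qed

lemma Theta_minus: "f \<in> L p \<Longrightarrow> Theta p (- f) = - Theta p f"
  using Theta_scale[of f p "-1"] by (simp add: scale_cochain_def fun_Compl_def)

text \<open>Since \<Delta> is odd with vanishing square, the Jacobi identity makes the double
  bracket equal to its own negative, and 2 is invertible.\<close>

lemma lb_dl_lb_dl:
  assumes "x \<in> CY sD sD (Suc d)"
  shows "G.lb (Suc 0) (Suc d) dl (G.lb (Suc 0) d dl x) = 0"
proof -
  let ?z = "G.lb (Suc 0) (Suc d) dl (G.lb (Suc 0) d dl x)"
  have "?z = G.lb (Suc (Suc 0)) d (G.lb (Suc 0) (Suc 0) dl dl) x + signed (Suc 0) ?z"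
    using G.lb_Jacobi[OF dl_CY dl_CY assms] by simp
  then have "?z = - ?z"
    using G.lb_zero_left[OF assms] by (simp add: lb_dl_dl signed_def)
  then have "?z + ?z = 0"
    by (metis add.right_inverse)
  then have "scale_cochain sD 2 ?z = 0"
    using G.scale_left_distrib[of 1 1 ?z] by simp
  then show ?thesis by simp
qed

lemma lb_dl_Theta: "f \<in> L p \<Longrightarrow> G.lb (Suc 0) p dl (Theta p f) = 0"
  by (cases p)
    (simp_all add: Theta_0 Theta_Suc lb_dl_ad G.lb_signed_right[OF dl_CY lb_dl_CY]
      lb_dl_lb_dl[OF extend_zero_CY])

section \<open>The bracket of homogeneous cochains\<close>

abbreviation "bh \<equiv> bracket_hom scaleA mul scaleM lact ract"

lemma cochain0_CY: "cochain0 a \<in> L 0"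
  by (auto simp: CY_iff cochain0_def Y_0)

lemma bh_0_0: "bh 0 0 f g =
    cochain0 (mul (f Leaf []) (g Leaf []) - mul (g Leaf []) (f Leaf []))"
  by (simp add: bracket_hom_def)

text \<open>The explicit bracket with an element of A is operadic too: \<open>ad a\<close> applied
  after \<open>g\<close> gives the commutator with the value of \<open>g\<close>, and
  \<open>ad a\<close> inserted into \<open>g\<close> changes one entry at a time.\<close>

lemma lb_ad_extend_zero:
  "G.lb 0 e (ad a) (extend_zero g) = extend_zero (- bracket_elem mul lact ract (Suc e) g a)"
  if g: "g \<in> L (Suc e)"
proof (intro ext)
  fix y xs
  show "G.lb 0 e (ad a) (extend_zero g) y xs =
      extend_zero (- bracket_elem mul lact ract (Suc e) g a) y xs"
  proof (cases "y \<in> Y (Suc e) \<and> length xs = Suc e")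
    case True
    then have y: "y \<in> Y (Suc e)" "y \<in> Y (Suc (0 + e))" "y \<in> Y (Suc (e + 0))" and len: "length xs = Suc e"
      by simp_all
    \<comment> \<open>The outer operation is unary, so both intervals of leaves to delete are
      empty.\<close>
    have "R_inner (Suc 0) (Suc 0) (Suc e) y = y"
    proof -
      have "delete_leaves ({..<0} \<union> {Suc (Suc e)..Suc e}) y = y" by simp
      then show ?thesis by (simp add: R_inner_def)
    qed
    then have 1: "G.pl 0 e (ad a) (extend_zero g) y xs =
        (mul a (g y (map snd xs)) - mul (g y (map snd xs)) a, 0)"
      using True R_outer_in_Y[OF le_refl y(2)]
      by (simp add: G.pl_def circ_def ad_def extend_zero_def action_simps)
    have "circ (Suc e) (Suc 0) (Suc i) (extend_zero g) (ad a) y xs =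
        (g y ((map snd xs)[i := lact a (map snd xs ! i) - ract (map snd xs ! i) a]), 0)"
      if "i \<le> e" for i
    proof -
      have "drop i xs = xs ! i # drop (Suc i) xs"
        using that len by (intro Cons_nth_drop_Suc[symmetric]) simp
      then have "take (Suc 0) (drop i xs) = [xs ! i]"
        by simp
      then have "circ (Suc e) (Suc 0) (Suc i) (extend_zero g) (ad a) y xs =
          extend_zero g y (take i xs @ ad a (R_inner (Suc e) (Suc i) (Suc 0) y) [xs ! i] # drop (Suc i) xs)"
        using True by (simp add: circ_def R_outer_def)
      also have "ad a (R_inner (Suc e) (Suc i) (Suc 0) y) [xs ! i] =
          (mul a (fst (xs ! i)) - mul (fst (xs ! i)) a, lact a (snd (xs ! i)) - ract (snd (xs ! i)) a)"
        using R_inner_in_Y[OF that y(3)] by (simp add: ad_def)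
      finally show ?thesis
        using that len
        by (subst upd_conv_take_nth_drop) (simp_all add: extend_zero_def take_map drop_map)
    qed
    then have "G.pl e 0 (extend_zero g) (ad a) y xs =
        (\<Sum>i\<le>e. (g y ((map snd xs)[i := lact a (map snd xs ! i) - ract (map snd xs ! i) a]), 0))"
      by (simp add: G.pl_def sum_cochain)
    also have "\<dots> = (\<Sum>i\<le>e. g y ((map snd xs)[i := lact a (map snd xs ! i) - ract (map snd xs ! i) a]), 0)"
      by (simp add: prod_eq_iff fst_sum snd_sum)
    finally have "G.lb 0 e (ad a) (extend_zero g) y xs =
        (mul a (g y (map snd xs)) - mul (g y (map snd xs)) a, 0) -
        (\<Sum>i\<le>e. g y ((map snd xs)[i := lact a (map snd xs ! i) - ract (map snd xs ! i) a]), 0)"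
      by (simp only: G.lb_def fun_diff_def 1 mult_0 signed_0)
    then show ?thesis
      by (simp add: extend_zero_def bracket_elem_def lessThan_Suc_atMost
          del: sum.atMost_Suc sum.lessThan_Suc)
  next
    case False
    then have "G.lb 0 e (ad a) (extend_zero g) y xs = 0"
      using G.lb_closed[OF ad_CY extend_zero_CY[OF g]] by (intro CY_zero) simp_all
    \<comment> \<open>Needed for \<open>bracket_elem\<close>, whose updates of the list keep its
      length.\<close>
    moreover have "g y us = 0" if "length us = length xs" for us
      using CY_zero[OF g, of y us] that False by auto
    ultimately show ?thesis
      by (simp add: extend_zero_def bracket_elem_def action_simps zero_prod_def)
  qed
qed

text \<open>The operadic bracket lowers the M-degree by its full arity, so it is an extension by
  zero. This gives the description in \<open>bracket_pos\<close> a solution and carries identities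
  of the operad over to \<open>bh\<close>.\<close>

lemma
  assumes f: "f \<in> L p" and g: "g \<in> L (Suc e)"
  shows bh_CY_Suc: "bh p (Suc e) f g \<in> L (Suc (p + e))"
    and extend_zero_bh: "extend_zero (bh p (Suc e) f g) = G.lb p e (Theta p f) (extend_zero g)"
proof -
  let ?F = "G.lb p e (Theta p f) (extend_zero g)"
  obtain h where h: "h \<in> L (Suc (p + e))" "extend_zero h = ?F"
    using lowers_arity_imp_extend_zero[of ?F "Suc (p + e)"]
      G.lb_closed[OF Theta_CY[OF f] extend_zero_CY[OF g]]
      lowers_lb[OF Theta_CY[OF f] extend_zero_CY[OF g] lowers_Theta[OF f] lowers_extend_zero[OF g]]
    by auto
  have "bh p (Suc e) f g = h"
  proof (cases p)
    case 0
    then show ?thesis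
      using h g by (simp add: bracket_hom_def Theta_0 lb_ad_extend_zero extend_zero_inject)
  next
    case (Suc d)
    have "signed p (MM_bracket (p + 1) (Suc e) (MM_bracket 2 p dl (extend_zero f)) (extend_zero g)) = ?F"
      using f g G.lb_signed_left[OF lb_dl_CY extend_zero_CY, of f d g e "Suc d"]
      by (simp add: Suc numeral_2_eq_2 MM_bracket_lb Theta_Suc)
    \<comment> \<open>Uniqueness is the injectivity of extension by zero.\<close>
    moreover have "(THE h. h \<in> L (p + Suc e) \<and> extend_zero h = ?F) = h"
      using h by (intro the_equality) (auto simp: extend_zero_inject[symmetric, of _ h])
    ultimately show ?thesis
      using Suc by (simp add: bracket_hom_def bracket_pos_def)
  qed
  with h show "bh p (Suc e) f g \<in> L (Suc (p + e))" "extend_zero (bh p (Suc e) f g) = ?F"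
    by simp_all
qed

text \<open>Extensions by zero commute with each other. Bracketing their zero bracket with \<Delta>
  therefore relates \<open>[[\<Delta>, f], g]\<close> to \<open>[f, [\<Delta>, g]]\<close>, up to
  sign.\<close>

lemma bh_skew:
  assumes f: "f \<in> L p" and g: "g \<in> L q"
  shows "bh p q f g = - signed (p * q) (bh q p g f)"
proof (cases "p = 0 \<or> q = 0")
  \<comment> \<open>When a degree is 0, skewness is built into \<open>bracket_hom\<close>.\<close>
  case True
  then show ?thesis
    by (auto simp: bracket_hom_def cochain0_def fun_eq_iff)
next
  case False
  then obtain d e where de: "p = Suc d" "q = Suc e"
    by (metis not0_implies_Suc)
  let ?f = "extend_zero f" and ?g = "extend_zero g"
  have f': "?f \<in> CY sD sD (Suc d)" and g': "?g \<in> CY sD sD (Suc e)"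
    using f g de by (simp_all add: extend_zero_CY)
  have c: "G.lb (Suc 0) d dl ?f \<in> CY sD sD (Suc (Suc d))" "G.lb (Suc 0) e dl ?g \<in> CY sD sD (Suc (Suc e))"
    using lb_dl_CY f g de by simp_all
  have "G.lb (Suc 0) (d + e) dl (G.lb d e ?f ?g) = 0"
    using lb_extend_zero[of f d g e] f g de G.lb_zero_right[OF dl_CY] by simp
  then have "G.lb (Suc d) e (G.lb (Suc 0) d dl ?f) ?g =
      - signed d (G.lb d (Suc e) ?f (G.lb (Suc 0) e dl ?g))"
    using G.lb_Jacobi[OF dl_CY f' g'] by (simp add: eq_neg_iff_add_eq_0)
  also have "\<dots> = signed (d + Suc e * d) (G.lb (Suc e) d (G.lb (Suc 0) e dl ?g) ?f)"
    using G.lb_skew[of d "Suc e" ?f "G.lb (Suc 0) e dl ?g"] by (simp add: signed_minus signed_signed)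
  finally have "G.lb p e (Theta p f) ?g = - signed (p * q) (G.lb q d (Theta q g) ?f)"
    unfolding de Theta_Suc G.lb_signed_left[OF c(1) g'] G.lb_signed_left[OF c(2) f'] signed_signed
    by (cases "even d"; cases "even e") (simp_all add: signed_def)
  then have "extend_zero (bh p q f g) = extend_zero (- signed (p * q) (bh q p g f))"
    using extend_zero_bh[of f p g e] extend_zero_bh[of g q f d] f g de
    by (simp add: extend_zero_minus extend_zero_signed)
  then show ?thesis
    by (simp only: extend_zero_inject)
qed

sublocale H: vector_space "scale_cochain scaleA :: 'k \<Rightarrow> ('m, 'a) cochain \<Rightarrow> ('m, 'a) cochain"
  by (rule vector_space_scale_cochain) (rule vector_space_axioms)

lemma subspace_L: "H.subspace (L n)"
  by (rule subspace_CY) (rule M.vector_space_axioms vector_space_axioms)+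

lemma bh_CY:
  assumes f: "f \<in> L p" and g: "g \<in> L q"
  shows "bh p q f g \<in> L (p + q)"
proof (cases q)
  case 0
  show ?thesis
  proof (cases p)
    case (Suc d)
    then have "bh q p g f \<in> L (p + q)"
      using bh_CY_Suc[OF g, of f d] f by (simp add: add.commute)
    then show ?thesis
      using bh_skew[OF f g] by (simp add: H.subspace_neg H.subspace_signed subspace_L)
  qed (simp add: 0 bh_0_0 cochain0_CY)
qed (use bh_CY_Suc[OF f] g in simp)

lemma bracket_elem_add:
  "bracket_elem mul lact ract m (f + f') a = bracket_elem mul lact ract m f a + bracket_elem mul lact ract m f' a"
  by (simp add: bracket_elem_def fun_eq_iff sum.distrib action_simps)

lemma bracket_elem_scale:
  "bracket_elem mul lact ract m (scale_cochain scaleA c f) a =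
     scale_cochain scaleA c (bracket_elem mul lact ract m f a)"
  by (simp add: bracket_elem_def fun_eq_iff scale_cochain_def scale_sum_right action_simps
      scale_right_distrib scale_right_diff_distrib)

lemma bh_add_left:
  assumes "f \<in> L p" "f' \<in> L p" "g \<in> L q"
  shows "bh p q (f + f') g = bh p q f g + bh p q f' g"
proof (cases q)
  case 0
  then show ?thesis
    by (simp add: bracket_hom_def bracket_elem_add)
      (auto simp: cochain0_def fun_eq_iff action_simps)
next
  case (Suc e)
  note ff' = H.subspace_add[OF subspace_L assms(1,2)]
  have "extend_zero (bh p q (f + f') g) = extend_zero (bh p q f g + bh p q f' g)"
    using assms ff' G.lb_add_left[OF Theta_CY Theta_CY extend_zero_CY, of f p f' g e]
    by (simp add: Suc extend_zero_bh extend_zero_add Theta_add)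
  then show ?thesis
    by (simp only: extend_zero_inject)
qed

lemma bh_scale_left:
  assumes "f \<in> L p" "g \<in> L q"
  shows "bh p q (scale_cochain scaleA c f) g = scale_cochain scaleA c (bh p q f g)"
proof (cases q)
  case 0
  then show ?thesis
    by (simp add: bracket_hom_def bracket_elem_scale)
      (auto simp: cochain0_def fun_eq_iff action_simps scale_cochain_def scale_right_diff_distrib)
next
  case (Suc e)
  note cf = H.subspace_scale[OF subspace_L assms(1), of c]
  have "extend_zero (bh p q (scale_cochain scaleA c f) g) =
      extend_zero (scale_cochain scaleA c (bh p q f g))"
    using assms cf G.lb_scale_left[OF Theta_CY extend_zero_CY, of f p g e c]
    by (simp add: Suc extend_zero_bh extend_zero_scale Theta_scale)
  then show ?thesis
    by (simp only: extend_zero_inject)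
qed

lemma bh_add_right:
  assumes "f \<in> L p" "g \<in> L q" "g' \<in> L q"
  shows "bh p q f (g + g') = bh p q f g + bh p q f g'"
  using bh_skew[OF assms(1) H.subspace_add[OF subspace_L assms(2,3)]]
    bh_skew[OF assms(1,2)] bh_skew[OF assms(1,3)] bh_add_left[OF assms(2,3,1)]
  by (simp add: signed_add)

lemma bh_scale_right:
  assumes "f \<in> L p" "g \<in> L q"
  shows "bh p q f (scale_cochain scaleA c g) = scale_cochain scaleA c (bh p q f g)"
  using bh_skew[OF assms(1) H.subspace_scale[OF subspace_L assms(2)], of c]
    bh_skew[OF assms] bh_scale_left[OF assms(2,1), of c]
  by (simp add: H.scale_signed)

lemma bh_minus_right: "\<lbrakk>f \<in> L p; g \<in> L q\<rbrakk> \<Longrightarrow> bh p q f (- g) = - bh p q f g"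
  using bh_scale_right[of f p g q "-1"] by simp

lemma bh_zero_left: "g \<in> L q \<Longrightarrow> bh p q 0 g = 0"
  using bh_scale_left[of 0 p g q 0] H.subspace_0[OF subspace_L] by simp

lemma bh_zero_right: "f \<in> L p \<Longrightarrow> bh p q f 0 = 0"
  using bh_scale_right[of f p 0 q 0] H.subspace_0[OF subspace_L] by simp

text \<open>For \<open>q > 0\<close> this is the Jacobi identity for \<Delta>,
  \<open>Theta p f\<close> and \<open>g\<close>, where \<Delta> commutes with
  \<open>Theta p f\<close>. For \<open>q = 0 < p\<close> the arguments are exchanged, and for
  \<open>p = q = 0\<close> the map \<open>ad\<close> respects commutators.\<close>

lemma Theta_bh:
  assumes f: "f \<in> L p" and g: "g \<in> L q"
  shows "Theta (p + q) (bh p q f g) = G.lb p q (Theta p f) (Theta q g)"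
proof -
  have pos: "Theta (p + Suc e) (bh p (Suc e) f g) = G.lb p (Suc e) (Theta p f) (Theta (Suc e) g)"
    if f: "f \<in> L p" and g: "g \<in> L (Suc e)" for p e f g
  proof -
    note T = Theta_CY[OF f] and g' = extend_zero_CY[OF g]
    have "G.lb (Suc 0) (p + e) dl (G.lb p e (Theta p f) (extend_zero g)) =
        signed p (G.lb p (Suc e) (Theta p f) (G.lb (Suc 0) e dl (extend_zero g)))"
      using G.lb_Jacobi[OF dl_CY T g'] G.lb_zero_left[OF g'] by (simp add: lb_dl_Theta[OF f])
    then show ?thesis
      using extend_zero_bh[OF f g] G.lb_signed_right[OF T lb_dl_CY[OF g], of "Suc e"]
      by (simp add: Theta_Suc signed_signed) (simp add: signed_def)
  qed
  show ?thesis
  proof (cases q)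
    case 0
    show ?thesis
    proof (cases p)
      case (Suc d)
      have "bh p 0 f g = - bh 0 p g f"
        using bh_skew[OF f g] 0 by simp
      then show ?thesis
        using pos[of g 0 f d] bh_CY_Suc[of g 0 f d] Theta_minus[of "bh 0 p g f" p]
          G.lb_skew[of 0 p "Theta 0 g" "Theta p f"] f g \<open>q = 0\<close> \<open>p = Suc d\<close>
        by simp
    qed (simp add: 0 bh_0_0 Theta_0 lb_ad_ad cochain0_def)
  qed (use pos f g in simp)
qed

text \<open>As \<open>f\<close> and \<open>g\<close> act on \<open>h\<close> through
  \<open>Theta\<close>, which respects brackets, this is the operadic Jacobi identity for
  \<open>Theta p f\<close>, \<open>Theta q g\<close> and the extension of \<open>h\<close>.\<close>

lemma bh_Jacobi_Suc:
  assumes f: "f \<in> L p" and g: "g \<in> L q" and h: "h \<in> L (Suc e)"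
  shows "bh p (q + Suc e) f (bh q (Suc e) g h) =
    bh (p + q) (Suc e) (bh p q f g) h + signed (p * q) (bh q (p + Suc e) g (bh p (Suc e) f h))"
proof -
  have "extend_zero (bh p (q + Suc e) f (bh q (Suc e) g h)) =
    extend_zero (bh (p + q) (Suc e) (bh p q f g) h + signed (p * q) (bh q (p + Suc e) g (bh p (Suc e) f h)))"
    using G.lb_Jacobi[OF Theta_CY[OF f] Theta_CY[OF g] extend_zero_CY[OF h]]
      extend_zero_bh[OF f, of "bh q (Suc e) g h" "q + e"] extend_zero_bh[OF g h]
      extend_zero_bh[OF bh_CY[OF f g] h] extend_zero_bh[OF f h]
      extend_zero_bh[OF g, of "bh p (Suc e) f h" "p + e"]
      bh_CY_Suc[OF g h] bh_CY_Suc[OF f h]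
    by (simp add: extend_zero_add extend_zero_signed Theta_bh[OF f g])
  then show ?thesis
    by (simp only: extend_zero_inject)
qed

text \<open>
  The Jacobi identity is invariant under permutations of its arguments, so it suffices to
  have one argument of positive degree, moved to the last place; in degree \<open>0\<close> it is the
  Jacobi identity of the commutator.
\<close>

lemma bh_Jacobi:
  assumes f: "f \<in> L p" and g: "g \<in> L q" and h: "h \<in> L r"
  shows "bh p (q + r) f (bh q r g h) =
    bh (p + q) r (bh p q f g) h + signed (p * q) (bh q (p + r) g (bh p r f h))"
proof -
  consider e where "r = Suc e" | e where "r = 0" "q = Suc e" | d where "r = 0" "q = 0" "p = Suc d"
    | "r = 0" "q = 0" "p = 0"
    by (metis not0_implies_Suc)
  then show ?thesis
  proof cases
    case 1
    then show ?thesis using bh_Jacobi_Suc[OF f g] h by simp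
  next
    case 2
    have "bh p q f (bh 0 q h g) = bh p q (bh p 0 f h) g + bh 0 (p + q) h (bh p q f g)"
      using bh_Jacobi_Suc[OF f h, of g e] g 2 by simp
    moreover have "bh 0 q h g = - bh q 0 g h"
      using bh_skew[OF h g] 2 by simp
    moreover have "bh p q (bh p 0 f h) g = - signed (p * q) (bh q p g (bh p 0 f h))"
      using bh_skew[OF bh_CY[OF f h] g] 2 by simp
    moreover have "bh 0 (p + q) h (bh p q f g) = - bh (p + q) 0 (bh p q f g) h"
      using bh_skew[OF h bh_CY[OF f g]] 2 by simp
    moreover have "bh p q f (- bh q 0 g h) = - bh p q f (bh q 0 g h)"
      using bh_minus_right[OF f bh_CY[OF g h]] 2 by simp
    ultimately show ?thesis
      using 2 by (simp add: algebra_simps)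
  next
    case 3
    have "bh 0 p g (bh 0 p h f) = bh 0 p (bh 0 0 g h) f + bh 0 p h (bh 0 p g f)"
      using bh_Jacobi_Suc[OF g h, of f d] f 3 by simp
    moreover have "bh 0 p h f = - bh p 0 f h" "bh 0 p g f = - bh p 0 f g"
      using bh_skew[OF h f] bh_skew[OF g f] 3 by simp_all
    moreover have "bh 0 p g (- bh p 0 f h) = - bh 0 p g (bh p 0 f h)"
      "bh 0 p h (- bh p 0 f g) = - bh 0 p h (bh p 0 f g)"
      using bh_minus_right[OF g bh_CY[OF f h]] bh_minus_right[OF h bh_CY[OF f g]] 3 by simp_all
    moreover have "bh 0 p (bh 0 0 g h) f = - bh p 0 f (bh 0 0 g h)"
      using bh_skew[OF bh_CY[OF g h] f] 3 by simp
    moreover have "bh 0 p h (bh p 0 f g) = - bh p 0 (bh p 0 f g) h"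
      using bh_skew[OF h bh_CY[OF f g]] 3 by simp
    ultimately show ?thesis
      using 3 by (simp add: algebra_simps)
  next
    case 4
    then show ?thesis
      by (simp add: bh_0_0) (auto simp: cochain0_def fun_eq_iff action_simps mul_assoc algebra_simps)
  qed
qed

section \<open>The direct sum\<close>

abbreviation "br \<equiv> bracket scaleA mul scaleM lact ract"

lemma component_of_CY: "f \<in> L p \<Longrightarrow> component n f = (if n = p then f else 0)"
  using CY_zero[of f scaleM scaleA p] by (auto simp: component_def fun_eq_iff Y_def)

lemma component_add: "component n (F + F') = component n F + (component n F' :: ('m, 'a) cochain)"
  by (simp add: component_def fun_eq_iff)

lemma component_scale:
  "component n (scale_cochain scaleA c F) = scale_cochain scaleA c (component n F)"
  by (simp add: component_def fun_eq_iff scale_cochain_def)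

lemma component_zero [simp]: "component n (0 :: ('m, 'a) cochain) = 0"
  by (simp add: component_def fun_eq_iff)

abbreviation "V \<equiv> H.span (\<Union>n. L n)"

lemma
  assumes "F \<in> V"
  shows component_CY: "component n F \<in> L n"
    and finite_components: "finite {n. component n F \<noteq> 0}"
proof -
  have "finite {n. component n F \<noteq> 0} \<and> (\<forall>n. component n F \<in> L n)"
    using assms
  proof (induction F rule: H.span_induct_alt)
    case base
    then show ?case using H.subspace_0[OF subspace_L] by (simp flip: zero_fun_def)
  next
    case (step c f F)
    then obtain p where p: "f \<in> L p" by blast
    have "{n. component n (scale_cochain scaleA c f + F) \<noteq> 0} \<subseteq> insert p {n. component n F \<noteq> 0}"
      using p by (auto simp: component_add component_scale component_of_CY split: if_splits)
    then have "finite {n. component n (scale_cochain scaleA c f + F) \<noteq> 0}"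
      by (rule finite_subset) (use conjunct1[OF step(2)] in \<open>simp only: finite_insert\<close>)
    moreover have "component n (scale_cochain scaleA c f + F) \<in> L n" for n
      using step p H.subspace_add[OF subspace_L] H.subspace_scale[OF subspace_L]
        H.subspace_0[OF subspace_L]
      by (simp add: component_add component_scale component_of_CY)
    ultimately show ?case by blast
  qed
  then show "component n F \<in> L n" "finite {n. component n F \<noteq> 0}"
    by blast+
qed

text \<open>Enlarging the supports to arbitrary finite index sets adds only zero terms. This allows
  common index sets for \<open>F\<close>, \<open>F'\<close> and their sum when proving
  bilinearity.\<close>

lemma br_eq:
  assumes "F \<in> V" "F' \<in> V" "finite N" "{n. component n F \<noteq> 0} \<subseteq> N"
    and "finite N'" "{n. component n F' \<noteq> 0} \<subseteq> N'"
  shows "br F F' = (\<Sum>m\<in>N. \<Sum>n\<in>N'. bh m n (component m F) (component n F'))"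
proof -
  have "br F F' = (\<Sum>m | component m F \<noteq> 0. \<Sum>n\<in>N'. bh m n (component m F) (component n F'))"
    unfolding bracket_def using assms
    by (intro sum.cong refl sum.mono_neutral_left) (auto simp: bh_zero_right component_CY)
  also have "\<dots> = (\<Sum>m\<in>N. \<Sum>n\<in>N'. bh m n (component m F) (component n F'))"
    using assms by (intro sum.mono_neutral_left) (auto simp: bh_zero_left component_CY intro!: sum.neutral)
  finally show ?thesis .
qed

lemma L_subset_V: "f \<in> L p \<Longrightarrow> f \<in> V"
  by (intro H.span_base) blast

lemma br_homogeneous:
  assumes "f \<in> L p" "g \<in> L q"
  shows "br f g = bh p q f g"
proof -
  \<comment> \<open>Only inclusions hold, because the support of 0 is empty.\<close>
  have "{n. component n f \<noteq> 0} \<subseteq> {p}" "{n. component n g \<noteq> 0} \<subseteq> {q}"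
    using assms by (auto simp: component_of_CY split: if_splits)
  then show ?thesis
    using br_eq[OF L_subset_V[OF assms(1)] L_subset_V[OF assms(2)], of "{p}" "{q}"] assms
    by (simp add: component_of_CY)
qed

lemma br_add_left:
  assumes "F \<in> V" "F' \<in> V" "K \<in> V"
  shows "br (F + F') K = br F K + br F' K"
proof -
  let ?S = "\<lambda>F. {n. component n F \<noteq> 0}"
  let ?N = "?S F \<union> ?S F'"
  have fin: "finite ?N" "finite (?S K)"
    using assms finite_components by auto
  have sub: "?S (F + F') \<subseteq> ?N"
    by (auto simp: component_add)
  show ?thesis
    using br_eq[OF H.span_add[OF assms(1,2)] assms(3) fin(1) sub fin(2)]
      br_eq[OF assms(1,3) fin(1) _ fin(2)] br_eq[OF assms(2,3) fin(1) _ fin(2)] assms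
    by (simp add: component_add bh_add_left component_CY sum.distrib)
qed

lemma br_add_right:
  assumes "F \<in> V" "F' \<in> V" "K \<in> V"
  shows "br K (F + F') = br K F + br K F'"
proof -
  let ?S = "\<lambda>F. {n. component n F \<noteq> 0}"
  let ?N = "?S F \<union> ?S F'"
  have fin: "finite ?N" "finite (?S K)"
    using assms finite_components by auto
  have sub: "?S (F + F') \<subseteq> ?N"
    by (auto simp: component_add)
  show ?thesis
    using br_eq[OF assms(3) H.span_add[OF assms(1,2)] fin(2) _ fin(1) sub]
      br_eq[OF assms(3,1) fin(2) _ fin(1)] br_eq[OF assms(3,2) fin(2) _ fin(1)] assms
    by (simp add: component_add bh_add_right component_CY sum.distrib)
qed

lemma br_scale_left:
  assumes "F \<in> V" "K \<in> V"
  shows "br (scale_cochain scaleA c F) K = scale_cochain scaleA c (br F K)"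
proof -
  have "{n. component n (scale_cochain scaleA c F) \<noteq> 0} \<subseteq> {n. component n F \<noteq> 0}"
    by (auto simp: component_scale)
  then show ?thesis
    using br_eq[OF H.span_scale[OF assms(1), of c] assms(2), of "{n. component n F \<noteq> 0}" "{n. component n K \<noteq> 0}"]
      br_eq[OF assms, of "{n. component n F \<noteq> 0}" "{n. component n K \<noteq> 0}"] assms
    by (simp add: finite_components component_scale bh_scale_left component_CY H.scale_sum_right)
qed

lemma br_scale_right:
  assumes "F \<in> V" "K \<in> V"
  shows "br F (scale_cochain scaleA c K) = scale_cochain scaleA c (br F K)"
proof -
  have "{n. component n (scale_cochain scaleA c K) \<noteq> 0} \<subseteq> {n. component n K \<noteq> 0}"
    by (auto simp: component_scale)
  then show ?thesis
    using br_eq[OF assms(1) H.span_scale[OF assms(2), of c], of "{n. component n F \<noteq> 0}" "{n. component n K \<noteq> 0}"]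
      br_eq[OF assms, of "{n. component n F \<noteq> 0}" "{n. component n K \<noteq> 0}"] assms
    by (simp add: finite_components component_scale bh_scale_right component_CY H.scale_sum_right)
qed

lemma L_direct:
  assumes "finite N" "\<And>n. n \<in> N \<Longrightarrow> x n \<in> L n" "(\<Sum>n\<in>N. x n) = 0" "n \<in> N"
  shows "x n = 0"
proof -
  have "component n (\<Sum>k\<in>N. x k) = (\<Sum>k\<in>N. component n (x k))"
    by (auto simp: component_def fun_eq_iff sum_cochain)
  also have "\<dots> = (\<Sum>k\<in>N. if n = k then x k else 0)"
    using assms(2) by (intro sum.cong refl component_of_CY)
  also have "\<dots> = x n"
    using assms(1,4) by simp
  finally show ?thesis
    using assms(3) by simp
qed

lemma graded_Lie_algebra_bracket:
  "graded_Lie_algebra (scale_cochain scaleA) (CY scaleM scaleA) br"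
proof unfold_locales
  show "H.subspace (L n)" for n
    by (rule subspace_L)
  show "x n = 0" if "finite N" "\<And>n. n \<in> N \<Longrightarrow> x n \<in> L n" "(\<Sum>n\<in>N. x n) = 0" "n \<in> N" for N x n
    using that by (rule L_direct)
  fix f g h p q r
  assume f: "f \<in> L p" and g: "g \<in> L q"
  show "br f g \<in> L (p + q)"
    using f g by (simp add: br_homogeneous bh_CY)
  show "br f g = - signed (p * q) (br g f)"
    unfolding br_homogeneous[OF f g] br_homogeneous[OF g f] by (rule bh_skew[OF f g])
  assume h: "h \<in> L r"
  show "br f (br g h) = br (br f g) h + signed (p * q) (br g (br f h))"
    unfolding br_homogeneous[OF f g] br_homogeneous[OF f h] br_homogeneous[OF g h]
      br_homogeneous[OF f bh_CY[OF g h]] br_homogeneous[OF bh_CY[OF f g] h]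
      br_homogeneous[OF g bh_CY[OF f h]]
    by (rule bh_Jacobi[OF f g h])
qed (simp_all add: br_add_left br_add_right br_scale_left br_scale_right)

section \<open>Maurer-Cartan elements\<close>

lemma cochain1_CY:
  assumes "Vector_Spaces.linear scaleM scaleA P"
  shows "cochain1 P \<in> L (Suc 0)"
  using assms by (auto simp: CY_iff cochain1_def Y_1)

lemma relative_averaging_iff_Maurer_Cartan:
  assumes P: "Vector_Spaces.linear scaleM scaleA P"
  shows "relative_averaging_operator scaleA mul scaleM lact ract P \<longleftrightarrow>
    Maurer_Cartan L br (cochain1 P)"
proof -
  let ?c = "cochain1 P" and ?e = "extend_zero (cochain1 P)"
  let ?F = "G.lb (Suc 0) 0 (Theta (Suc 0) ?c) ?e"
  note c = cochain1_CY[OF P]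
  have F: "?F \<in> CY sD sD (Suc (Suc 0))"
    using G.lb_closed[OF Theta_CY[OF c] extend_zero_CY[OF c]] by simp
  have e: "?e y_one [x] = (P (snd x), 0)" for x
    by (simp add: extend_zero_def cochain1_def)
  \<comment> \<open>The derivation defect of the extension of \<open>P\<close>, with the sign
    reversed because \<open>Theta\<close> carries \<open>(-1)^p\<close> with
    \<open>p = 1\<close>.\<close>
  have T: "Theta (Suc 0) ?c y [x, x'] =
      ?e y_one [dl y [x, x']] - dl y [?e y_one [x], x'] - dl y [x, ?e y_one [x']]"
    if "y \<in> Y (Suc (Suc 0))" for y x x'
    using that by (simp add: Theta_Suc signed_def lb_1_0_eval)
  have ne: "y_vdash \<noteq> y_dashv"
    by (simp add: y_vdash_def y_dashv_def)
  \<comment> \<open>Here \<open>w\<close> is the defect of one averaging identity. The A-components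
    of \<open>x\<close> and \<open>x'\<close> drop out of the result, and the remaining terms pair
    up into two copies of \<open>w\<close>.\<close>
  have dashv: "?F y_dashv [x, x'] = (w + w, 0)"
    if "w = P (ract (snd x) (P (snd x'))) - mul (P (snd x)) (P (snd x'))" for x x' w
    using that by (simp add: lb_1_0_eval T Y_2 e action_simps linear_hom_props[OF P])
  have vdash: "?F y_vdash [x, x'] = (w + w, 0)"
    if "w = P (lact (P (snd x)) (snd x')) - mul (P (snd x)) (P (snd x'))" for x x' w
    using that ne by (simp add: lb_1_0_eval T Y_2 e action_simps linear_hom_props[OF P])
  \<comment> \<open>Characteristic 0 allows division by 2.\<close>
  have double: "w + w = 0 \<longleftrightarrow> w = 0" for w :: 'a
    using scale_left_distrib[of 1 1 w] scale_eq_0_iff[of 2 w] by simp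
  have "Maurer_Cartan L br ?c \<longleftrightarrow> bh (Suc 0) (Suc 0) ?c ?c = 0"
    using c by (simp add: Maurer_Cartan_def br_homogeneous[OF c c])
  also have "\<dots> \<longleftrightarrow> ?F = 0"
    using extend_zero_bh[OF c c] by (metis extend_zero_inject extend_zero_zero)
  also have "\<dots> \<longleftrightarrow> (\<forall>x x'. ?F y_dashv [x, x'] = 0 \<and> ?F y_vdash [x, x'] = 0)"
  proof
    assume "\<forall>x x'. ?F y_dashv [x, x'] = 0 \<and> ?F y_vdash [x, x'] = 0"
    then show "?F = 0"
      using G.subspace_0[OF G.subspace_C[of "Suc 0"]] by (intro CY_2_eqI[OF F]) (auto simp: Y_2)
  qed simp
  also have "\<dots> \<longleftrightarrow> (\<forall>u v. P (ract u (P v)) = mul (P u) (P v) \<and> P (lact (P u) v) = mul (P u) (P v))"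
    by (simp add: dashv[OF refl] vdash[OF refl] zero_prod_def double)
  also have "\<dots> \<longleftrightarrow> relative_averaging_operator scaleA mul scaleM lact ract P"
    using P by (auto simp: relative_averaging_operator_def)
  finally show ?thesis by blast
qed

end

theorem theorem4p1:
  fixes scaleA :: "'k :: field_char_0 \<Rightarrow> 'a :: ab_group_add \<Rightarrow> 'a"
    and mul :: "'a \<Rightarrow> 'a \<Rightarrow> 'a"
    and scaleM :: "'k \<Rightarrow> 'm :: ab_group_add \<Rightarrow> 'm"
    and lact :: "'a \<Rightarrow> 'm \<Rightarrow> 'm"
    and ract :: "'m \<Rightarrow> 'a \<Rightarrow> 'm"
  assumes "assoc_algebra scaleA mul"
    and "alg_bimodule scaleA mul scaleM lact ract"
  shows "graded_Lie_algebra (scale_cochain scaleA) (CY scaleM scaleA)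
           (bracket scaleA mul scaleM lact ract) \<and>
         (\<forall>P. Vector_Spaces.linear scaleM scaleA P \<longrightarrow>
            (relative_averaging_operator scaleA mul scaleM lact ract P \<longleftrightarrow>
             Maurer_Cartan (CY scaleM scaleA) (bracket scaleA mul scaleM lact ract)
               (cochain1 P)))"
  using alg_bimodule.graded_Lie_algebra_bracket[OF assms(2)]
    alg_bimodule.relative_averaging_iff_Maurer_Cartan[OF assms(2)]
  by blast

end
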